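(* Let $p\ge 2$ and $k\ge 2$ be integers. With the graphs $X^{(m)}$, the energies $E^{(m)}_n$, $E^{(m)}_b$ and the harmonic extension as defined in the context: (1) For every $m\ge 2$ and every function $u$ on $X^{(m-1)}$, the harmonic extension $\tilde u$ of $u$ to $X^{(m)}$ does not depend on the choice of the positive weights. It is obtained by interpolating linearly along the edges of type $k-1$ of $X^{(m-1)}$: each such edge $[x,y]$ contains $p$ edges of type $0$ of $X^{(m)}$ (its other pieces being loops), and $\tilde u$ has difference $\frac1p(u(y)-u(x))$ along each of these $p$ edges. Moreover $$E^{(m)}_{n'}(\tilde u)=\sum_{n=0}^{k-1}M_{n'n}E^{(m-1)}_n(u),\qquad 0\le n'\le k-1,$$ where $M$ is the $k\times k$ matrix (rows and columns indexed by $0,\dots,k-1$) with $M_{0,k-1}=p^{k-1}$, $M_{n,n-1}=1$ for $1\le n\le k-1$, and all other entries $0$. (2) $r=p^{\frac{k-1}{k}}$ and $b=(b_0,\dots,b_{k-1})=(1,r,r^2,\dots,r^{k-1})$ give the unique positive solution (up to multiplying $b$ by a positive scalar) of $r b_n=\sum_{n'=0}^{k-1}b_{n'}M_{n'n}$, $0\le n\le k-1$. For this choice, $E_b^{(m)}(\tilde u)=rE_b^{(m-1)}(u)$. (3) For this $r$ and $b$ put $\mathcal{E}^{(m)}(u)=r^{-m}E_b^{(m)}(u)$. Then $\mathcal{E}^{(m)}(\tilde u)=\mathcal{E}^{(m-1)}(u)$, and $\mathcal{E}(u)=\lim_{m\to\infty}\mathcal{E}^{(m)}(u)$ is well-defined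 in $[0,\infty]$ for functions $u$ on the circle that respect identifications, with $\mathcal{E}(u)=0$ if and only if $u$ is constant. (4) For every such $u$, $E_n^{(m)}(u\circ P)=p^2E_n^{(m-1)}(u)$ for each $n$, $E_b^{(m)}(u\circ P)=p^2E_b^{(m-1)}(u)$, and hence $$\mathcal{E}(u\circ P)=\frac{p^2}{r}\,\mathcal{E}(u)=p^{\frac{k+1}{k}}\mathcal{E}(u).$$ (5) The Laplacian $\Delta$ defined in the context satisfies $\Delta(u\circ P)=p^{\frac{k+1}{k}}(\Delta u)\circ P$.
   Context: The circle is $\mathbb{R}/\mathbb{Z}$, and $P(t)=pt \bmod 1$. Put $\theta=\frac{1}{p(p^k-1)}$ and divide the circle into the $p$ arcs $A_n=(\theta+\frac np,\theta+\frac{n+1}{p}]$ (mod 1), $n=0,\dots,p-1$. The kneading sequence of $t$ is $(n_0,n_1,\dots)$, where $p^jt \bmod 1\in A_{n_j}$ for $j=0,1,\dots$. Two points of the circle are identified if and only if they have the same kneading sequence; the circle with these identifications is the model of the Julia set (of a polynomial $z^p+c$ corresponding to the parameter $\theta$). A function on the circle respects identifications if it takes equal values at identified points. For $m\ge1$, the points of $X^{(m)}$ are the points $\frac{p^n+\ell(p^k-1)}{p^m(p^k-1)} \bmod 1$ with $1\le n\le k$, $0\le \ell\le p^m-1$; identified points represent the same vertex of the graph $X^{(m)}$. The edges are the arcs $[x,y]$ of the circle between neighbouring points of this set; loops (arcs whose endpoints are identified) are kept. An edge of $X^{(m)}$ is of type $n$ ($0\le n\le k-1$) if its length $|x-y|$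 is $\frac{p^n(p-1)}{p^m(p^k-1)}$. A function on $X^{(m)}$ is a function on its set of vertices, i.e. a function on its points that respects identifications. For a function $u$ on $X^{(m)}$ and positive weights $b_0,\dots,b_{k-1}$, $$E^{(m)}_n(u)=\sum_{[x,y]\text{ of type }n}\frac{|u(x)-u(y)|^2}{|x-y|},\qquad E^{(m)}_b(u)=\sum_{n=0}^{k-1}b_nE_n^{(m)}(u).$$ For a function $u$ on the circle that respects identifications, these are applied to its restriction to $X^{(m)}$. The harmonic extension of a function $u$ on $X^{(m-1)}$ is the extension $\tilde u$ of $u$ to $X^{(m)}$ that minimizes $E^{(m)}_b$ among all extensions. With $\mathcal{E}$ as in part (3), $u\in\mathrm{dom}(\mathcal{E})$ means $\mathcal{E}(u)<\infty$, and $\mathcal{E}(u,v)$ is the bilinear form obtained from the quadratic form $\mathcal{E}(u)=\mathcal{E}(u,u)$ by polarization. $\mu$ is Lebesgue measure on the circle; it satisfies $\int f\circ P\,d\mu=\int f\,d\mu$. The Laplacian $\Delta u$ is defined by the identity $\mathcal{E}(u,v)=-\int(\Delta u)\,v\,d\mu$ for all $v\in\mathrm{dom}(\mathcal{E})$.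
   Formalization: In (3), "E(u)=0 iff u is constant" is stated for continuous u; for arbitrary u, iff u is constant on the union of all vertex sets (literally it fails). In (5), dom(E) consists of continuous functions of finite energy, and Δu is an integrable function respecting identifications. *)

theory Defs
  imports "HOL-Analysis.Analysis"
begin

(*
  Points of the circle R/Z are given by their real representatives, and every subset of the
  circle by the 1-periodic set of all its representatives.
*)

definition theta :: "nat \<Rightarrow> nat \<Rightarrow> real" where
  "theta p k = 1 / (real p * (real p ^ k - 1))"

definition circle_map :: "nat \<Rightarrow> real \<Rightarrow> real" where
  "circle_map p t = frac (real p * t)"

definition part_arc :: "nat \<Rightarrow> nat \<Rightarrow> nat \<Rightarrow> real set" where
  "part_arc p k n =
     {t. \<exists>s \<in> {theta p k + real n / real p <.. theta p k + real (n + 1) / real p}. t - s \<in> \<int>}"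

definition kneading :: "nat \<Rightarrow> nat \<Rightarrow> real \<Rightarrow> nat \<Rightarrow> nat" where
  "kneading p k t j = (THE n. n < p \<and> frac (real p ^ j * t) \<in> part_arc p k n)"

definition identified :: "nat \<Rightarrow> nat \<Rightarrow> real \<Rightarrow> real \<Rightarrow> bool" where
  "identified p k s t \<longleftrightarrow> kneading p k s = kneading p k t"

(*
  Representatives of one circle point have the same kneading sequence, so a function on the
  reals that respects identifications on a 1-periodic set is in particular 1-periodic there,
  i.e. it is a function on the corresponding subset of the circle.
*)
definition respects_on :: "nat \<Rightarrow> nat \<Rightarrow> real set \<Rightarrow> (real \<Rightarrow> real) \<Rightarrow> bool" where
  "respects_on p k S u \<longleftrightarrow> (\<forall>s\<in>S. \<forall>t\<in>S. identified p k s t \<longrightarrow> u s = u t)"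

abbreviation respects_ident :: "nat \<Rightarrow> nat \<Rightarrow> (real \<Rightarrow> real) \<Rightarrow> bool" where
  "respects_ident p k u \<equiv> respects_on p k UNIV u"

definition X_points :: "nat \<Rightarrow> nat \<Rightarrow> nat \<Rightarrow> real set" where
  "X_points p k m =
     {t. \<exists>n\<in>{1..k}. \<exists>l\<in>{0..p ^ m - 1}.
           t - (real p ^ n + real l * (real p ^ k - 1)) / (real p ^ m * (real p ^ k - 1)) \<in> \<int>}"

(*
  The lifted arcs contain every edge in all its integer translates; the edges are the translates
  with left endpoint in [0,1), the right endpoint may exceed 1.
*)
definition lifted_arcs :: "nat \<Rightarrow> nat \<Rightarrow> nat \<Rightarrow> (real \<times> real) set" where
  "lifted_arcs p k m =
     {(x, y). x \<in> X_points p k m \<and> y \<in> X_points p k m \<and> x < y \<and> {x<..<y} \<inter> X_points p k m = {}}"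

definition X_edges :: "nat \<Rightarrow> nat \<Rightarrow> nat \<Rightarrow> (real \<times> real) set" where
  "X_edges p k m = {(x, y) \<in> lifted_arcs p k m. 0 \<le> x \<and> x < 1}"

definition of_type :: "nat \<Rightarrow> nat \<Rightarrow> nat \<Rightarrow> nat \<Rightarrow> real \<times> real \<Rightarrow> bool" where
  "of_type p k m n e \<longleftrightarrow>
     \<bar>fst e - snd e\<bar> = real p ^ n * (real p - 1) / (real p ^ m * (real p ^ k - 1))"

definition E_type :: "nat \<Rightarrow> nat \<Rightarrow> nat \<Rightarrow> nat \<Rightarrow> (real \<Rightarrow> real) \<Rightarrow> real" where
  "E_type p k m n u =
     (\<Sum>(x, y) \<in> {e \<in> X_edges p k m. of_type p k m n e}. \<bar>u x - u y\<bar>\<^sup>2 / \<bar>x - y\<bar>)"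

definition E_weighted :: "nat \<Rightarrow> nat \<Rightarrow> (nat \<Rightarrow> real) \<Rightarrow> nat \<Rightarrow> (real \<Rightarrow> real) \<Rightarrow> real" where
  "E_weighted p k b m u = (\<Sum>n<k. b n * E_type p k m n u)"

definition positive_weights :: "nat \<Rightarrow> (nat \<Rightarrow> real) \<Rightarrow> bool" where
  "positive_weights k b \<longleftrightarrow> (\<forall>n<k. 0 < b n)"

definition extension :: "nat \<Rightarrow> nat \<Rightarrow> nat \<Rightarrow> (real \<Rightarrow> real) \<Rightarrow> (real \<Rightarrow> real) \<Rightarrow> bool" where
  "extension p k m u w \<longleftrightarrow>
     respects_on p k (X_points p k m) w \<and> (\<forall>x\<in>X_points p k (m - 1). w x = u x)"

definition harmonic_extension ::
  "nat \<Rightarrow> nat \<Rightarrow> (nat \<Rightarrow> real) \<Rightarrow> nat \<Rightarrow> (real \<Rightarrow> real) \<Rightarrow> (real \<Rightarrow> real) \<Rightarrow> bool" where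
  "harmonic_extension p k b m u w \<longleftrightarrow>
     extension p k m u w \<and>
     (\<forall>w'. extension p k m u w' \<longrightarrow> E_weighted p k b m w \<le> E_weighted p k b m w')"

definition M_entry :: "nat \<Rightarrow> nat \<Rightarrow> nat \<Rightarrow> nat \<Rightarrow> real" where
  "M_entry p k i j =
     (if i = 0 \<and> j = k - 1 then real p ^ (k - 1)
      else if 1 \<le> i \<and> i \<le> k - 1 \<and> j = i - 1 then 1
      else 0)"

definition r_const :: "nat \<Rightarrow> nat \<Rightarrow> real" where
  "r_const p k = real p powr ((real k - 1) / real k)"

definition b_weights :: "nat \<Rightarrow> nat \<Rightarrow> nat \<Rightarrow> real" where
  "b_weights p k n = r_const p k ^ n"

definition E_renorm :: "nat \<Rightarrow> nat \<Rightarrow> nat \<Rightarrow> (real \<Rightarrow> real) \<Rightarrow> real" where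
  "E_renorm p k m u = E_weighted p k (b_weights p k) m u / r_const p k ^ m"

definition energy :: "nat \<Rightarrow> nat \<Rightarrow> (real \<Rightarrow> real) \<Rightarrow> ereal" where
  "energy p k u = lim (\<lambda>m. ereal (E_renorm p k m u))"

(*
  Continuity is needed here: a function that vanishes at all points of all the graphs has energy
  zero whatever its other values, so it would otherwise lie in the domain without being constant
  or even measurable. Since u respects identifications, continuity on the circle is the same as
  continuity on the quotient.
*)
definition dom_energy :: "nat \<Rightarrow> nat \<Rightarrow> (real \<Rightarrow> real) set" where
  "dom_energy p k = {u. respects_ident p k u \<and> continuous_on UNIV u \<and> energy p k u < \<infinity>}"

definition energy_form :: "nat \<Rightarrow> nat \<Rightarrow> (real \<Rightarrow> real) \<Rightarrow> (real \<Rightarrow> real) \<Rightarrow> real" where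
  "energy_form p k u v =
     (real_of_ereal (energy p k (\<lambda>t. u t + v t)) - real_of_ereal (energy p k (\<lambda>t. u t - v t))) / 4"

definition circle_measure :: "real measure" where
  "circle_measure = lebesgue_on {0..<1}"

definition is_laplacian :: "nat \<Rightarrow> nat \<Rightarrow> (real \<Rightarrow> real) \<Rightarrow> (real \<Rightarrow> real) \<Rightarrow> bool" where
  "is_laplacian p k u f \<longleftrightarrow>
     u \<in> dom_energy p k \<and> respects_ident p k f \<and> integrable circle_measure f \<and>
     (\<forall>v \<in> dom_energy p k. energy_form p k u v = - (LINT t|circle_measure. f t * v t))"

end

theory Submission
  imports Defs
begin

text \<open>
  Write \<open>Q = p^k - 1\<close>. The points of \<open>X_m\<close> are \<open>(j + p^n/Q) / p^m\<close>; for fixed \<open>j\<close> the points with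
  \<open>1 \<le> n \<le> k\<close> form block \<open>j\<close>, edges of type \<open>n \<ge> 1\<close> stay inside a block, and edges of type 0 join
  consecutive blocks. The points of \<open>X_(m-1)\<close> are those in blocks with \<open>p dvd j\<close>; every other block
  is one new vertex of \<open>X_m\<close>. So an edge of type \<open>n < k - 1\<close> of \<open>X_(m-1)\<close> is an edge of type \<open>n + 1\<close> of
  \<open>X_m\<close>, whereas an edge of type \<open>k - 1\<close> becomes a chain of \<open>p\<close> edges of type 0 with loops between
  them. Minimizing along the chain is minimizing a sum of \<open>p\<close> squares with given sum of the
  differences, which has the linear interpolation as its only solution whatever the weights are.

  For the Laplacian, let \<open>avg v\<close> be the mean of \<open>v\<close> over the \<open>p\<close> preimages under \<open>P\<close>. It respects
  identifications, and composition with \<open>P\<close> is adjoint to \<open>avg\<close> for the integral and, up to the factor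
  \<open>p^2/r\<close>, for the energy.
\<close>

section \<open>Finite sums\<close>

lemma sum_shift_periodic:
  fixes g :: "nat \<Rightarrow> 'a::ab_group_add"
  assumes "g N = g 0"
  shows "(\<Sum>j<N. g (Suc j)) = (\<Sum>j<N. g j)"
  using sum.lessThan_Suc[of g N] sum.lessThan_Suc_shift[of g N] assms by simp

lemma sum_blocks:
  fixes g :: "nat \<Rightarrow> 'a::comm_monoid_add"
  shows "(\<Sum>j<n * q. g j) = (\<Sum>L<n. \<Sum>i<q. g (q * L + i))"
proof -
  have "(\<Sum>i<q. g (q * L + i)) = sum g {L * q..<L * q + q}" for L
    using sum.shift_bounds_nat_ivl[of g 0 "L * q" q]
    by (simp add: atLeast0LessThan algebra_simps)
  then show ?thesis using sum.nat_group[of g q n] by simp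
qed

text \<open>The increments split orthogonally into their mean and the deviations from it. The last
  sum is what a chain with prescribed ends costs beyond linear interpolation.\<close>

lemma sum_square_increments:
  fixes a :: "nat \<Rightarrow> real"
  assumes "0 < n"
  shows "(\<Sum>i<n. (a (Suc i) - a i)\<^sup>2)
    = (a n - a 0)\<^sup>2 / real n + (\<Sum>i<n. (a (Suc i) - a i - (a n - a 0) / real n)\<^sup>2)"
proof -
  define c where "c = (a n - a 0) / real n"
  define d where "d i = a (Suc i) - a i" for i
  have nc: "real n * c = a n - a 0" using assms by (simp add: c_def)
  then have tele: "(\<Sum>i<n. d i) = real n * c"
    using sum_lessThan_telescope[of a n] by (simp add: d_def)
  have "(\<Sum>i<n. (d i - c)\<^sup>2) = (\<Sum>i<n. (d i)\<^sup>2 - 2 * c * d i + c\<^sup>2)"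
    by (intro sum.cong) (auto simp: power2_eq_square algebra_simps)
  also have "\<dots> = (\<Sum>i<n. (d i)\<^sup>2) - 2 * c * (real n * c) + real n * c\<^sup>2"
    unfolding sum.distrib sum_subtractf sum_distrib_left[symmetric] tele by simp
  finally have "(\<Sum>i<n. (d i)\<^sup>2) = (real n * c) * c + (\<Sum>i<n. (d i - c)\<^sup>2)"
    by (simp add: power2_eq_square algebra_simps)
  then show ?thesis
    unfolding nc by (simp add: d_def c_def power2_eq_square)
qed

locale julia_model =
  fixes p k :: nat
  assumes p_ge2: "2 \<le> p" and k_ge2: "2 \<le> k"
begin

subsection \<open>The graphs\<close>

definition Q :: real where
  "Q = real p ^ k - 1"

text \<open>Block \<open>j\<close> has the indices \<open>1..k\<close>. Index 0 is a second name for
  the last point of block \<open>j - 1\<close>, so that every edge runs from \<open>pt m j n\<close>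
  to \<open>pt m j (Suc n)\<close> with \<open>n < k\<close>. Letting \<open>j\<close> range over
  all integers covers all representatives of the circle points.\<close>

definition pt :: "nat \<Rightarrow> int \<Rightarrow> nat \<Rightarrow> real" where
  "pt m j n = (of_int j + real p ^ n / Q) / real p ^ m"

lemma p_gt1: "1 < real p" and p_pos: "0 < real p" and p_real_ge2: "2 \<le> real p"
  using p_ge2 by linarith+

lemma p_power_mono: "a \<le> b \<Longrightarrow> real p ^ a \<le> real p ^ b"
  using p_gt1 by (simp add: power_increasing)

lemma power_less_Q: "n < k \<Longrightarrow> real p ^ n < Q"
proof -
  assume "n < k"
  then have "real p ^ n \<le> real p ^ (k - 1)" by (intro p_power_mono) simp
  moreover have "real p ^ k = real p * real p ^ (k - 1)"
    using k_ge2 by (metis One_nat_def Suc_diff_le Suc_eq_plus1 add_diff_cancel_right' diff_Suc_1 le_trans one_le_numeral power_Suc)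
  moreover have "real p \<le> real p ^ (k - 1)"
    using k_ge2 p_power_mono[of 1 "k - 1"] by simp
  moreover have "2 * real p ^ (k - 1) \<le> real p * real p ^ (k - 1)"
    using p_real_ge2 by (intro mult_right_mono) auto
  ultimately show ?thesis
    unfolding Q_def using p_real_ge2 by linarith
qed

lemma Q_pos: "0 < Q"
  using power_less_Q[of 0] k_ge2 by simp

lemma power_k_over_Q: "real p ^ k / Q = 1 + 1 / Q"
  using Q_pos by (simp add: Q_def field_simps)

lemma power_over_Q_pos: "0 < real p ^ n / Q"
  using Q_pos p_pos by simp

lemma power_over_Q_lt1: "n < k \<Longrightarrow> real p ^ n / Q < 1"
  using power_less_Q Q_pos by simp

lemma power_over_Q_mono: "a \<le> b \<Longrightarrow> real p ^ a / Q \<le> real p ^ b / Q"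
  using p_power_mono Q_pos by (simp add: divide_right_mono)

lemma power_over_Q_strict_mono: "a < b \<Longrightarrow> real p ^ a / Q < real p ^ b / Q"
  using p_gt1 Q_pos by (simp add: divide_strict_right_mono)

lemma pt_wrap: "pt m j k = pt m (j + 1) 0"
  using power_k_over_Q by (simp add: pt_def algebra_simps)

lemma pt_refine: "pt (Suc m) (int p * j) (Suc n) = pt m j n"
  using p_pos by (simp add: pt_def field_simps)

lemma pt_translate: "pt m (j + int p ^ m * z) n = pt m j n + of_int z"
  using p_pos by (simp add: pt_def field_simps)

lemma pt_scale: "real p * pt (Suc m) j n = pt m j n"
  using p_pos by (simp add: pt_def field_simps)

lemma pt_preimage: "pt (Suc m) (j + int p ^ m * i) n = (pt m j n + of_int i) / real p"
  using p_pos by (simp add: pt_def field_simps)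

lemma pt_diff: "pt m j (Suc n) - pt m j n = real p ^ n * (real p - 1) / (real p ^ m * Q)"
  using p_pos Q_pos by (simp add: pt_def field_simps)

lemma length_pos: "0 < real p ^ n * (real p - 1) / (real p ^ m * Q)"
  using p_gt1 Q_pos by simp

text \<open>For indices below \<open>k\<close> the offset \<open>p^n / Q\<close> lies strictly
  between 0 and 1, so points are ordered first by block number and then by index.\<close>

lemma pt_less_iff:
  assumes "n < k" "n' < k"
  shows "pt m j n < pt m j' n' \<longleftrightarrow> j < j' \<or> (j = j' \<and> n < n')"
proof -
  have "pt m j n < pt m j' n' \<longleftrightarrow> of_int j + real p ^ n / Q < of_int j' + real p ^ n' / Q"
    unfolding pt_def using p_pos by (simp add: divide_less_cancel)
  also have "\<dots> \<longleftrightarrow> j < j' \<or> (j = j' \<and> n < n')"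
  proof (cases j j' rule: linorder_cases)
    case less
    then have "of_int j + 1 \<le> (of_int j' :: real)" by linarith
    then show ?thesis
      using less power_over_Q_lt1[OF assms(1)] power_over_Q_pos[of n'] by auto
  next
    case equal
    then show ?thesis
      using power_over_Q_strict_mono[of n n'] power_over_Q_mono[of n' n] by (cases "n < n'") auto
  next
    case greater
    then have "of_int j' + 1 \<le> (of_int j :: real)" by linarith
    then show ?thesis
      using greater power_over_Q_lt1[OF assms(2)] power_over_Q_pos[of n] by auto
  qed
  finally show ?thesis .
qed

lemma pt_eq_iff:
  assumes "n < k" "n' < k"
  shows "pt m j n = pt m j' n' \<longleftrightarrow> j = j' \<and> n = n'"
  using pt_less_iff[OF assms, of m j j'] pt_less_iff[OF assms(2,1), of m j' j]
  by (metis less_irrefl linorder_neqE_linordered_idom linorder_neqE_nat)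

text \<open>The residue \<open>l\<close> and the integer translate combine into one integer block
  number, because adding \<open>p^m\<close> to \<open>j\<close> moves the point by 1.\<close>

lemma X_points_eq: "X_points p k m = {pt m j n | j n. 1 \<le> n \<and> n \<le> k}"
proof -
  have base: "(real p ^ n + real l * (real p ^ k - 1)) / (real p ^ m * (real p ^ k - 1)) = pt m (int l) n"
    for n l
    using Q_pos p_pos by (simp add: pt_def Q_def field_simps)
  have "X_points p k m = {t. \<exists>n\<in>{1..k}. \<exists>l\<in>{0..p ^ m - 1}. t - pt m (int l) n \<in> \<int>}"
    unfolding X_points_def base ..
  also have "\<dots> = {pt m j n | j n. 1 \<le> n \<and> n \<le> k}"
  proof (intro set_eqI iffI; clarsimp)
    fix t n l
    assume n: "Suc 0 \<le> n" "n \<le> k" and "t - pt m (int l) n \<in> \<int>"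
    then obtain z where "t - pt m (int l) n = of_int z" by (auto elim: Ints_cases)
    then have "t = pt m (int l + int p ^ m * z) n" by (simp add: pt_translate)
    then show "\<exists>j n. t = pt m j n \<and> Suc 0 \<le> n \<and> n \<le> k" using n by blast
  next
    fix j n
    assume n: "Suc 0 \<le> n" "n \<le> k"
    have pm: "0 < int p ^ m" using p_ge2 by simp
    define l where "l = nat (j mod int p ^ m)"
    have l: "int l = j mod int p ^ m" using pm by (simp add: l_def)
    then have "int l < int (p ^ m)" using pm by simp
    then have "l < p ^ m" by linarith
    moreover have "pt m j n - pt m (int l) n = of_int (j div int p ^ m)"
      using pt_translate[of m "int l" "j div int p ^ m" n] by (simp add: l)
    ultimately show "\<exists>n'\<in>{Suc 0..k}. \<exists>l\<in>{0..p ^ m - Suc 0}. pt m j n - pt m (int l) n' \<in> \<int>"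
      using n by (intro bexI[of _ n] bexI[of _ l]) auto
  qed
  finally show ?thesis .
qed

lemma pt_in_X: "n \<le> k \<Longrightarrow> pt m j n \<in> X_points p k m"
  using pt_wrap[of m "j - 1"] k_ge2 unfolding X_points_eq
  by (cases "n = 0") (force intro: exI[of _ "j - 1"] exI[of _ k], force)

lemma X_points_cases:
  assumes "x \<in> X_points p k m"
  obtains j n where "x = pt m j n" "1 \<le> n" "n \<le> k"
  using assms unfolding X_points_eq by blast

text \<open>Two normal forms are in use: indices \<open>1..k\<close> keep a point in its block and
  suit kneading sequences, while indices \<open>0..k-1\<close> present it as the left end of an edge
  and suit the order.\<close>

lemma X_points_cases_less:
  assumes "x \<in> X_points p k m"
  obtains j n where "x = pt m j n" "n < k"
proof -
  obtain j n where "x = pt m j n" "1 \<le> n" "n \<le> k" using X_points_cases[OF assms] .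
  then show thesis
    using that[of j n] that[of "j + 1" 0] pt_wrap[of m j] k_ge2 by (cases "n = k") auto
qed

lemma pt_less_Suc: "pt m j n < pt m j (Suc n)"
  using pt_diff[of m j n] length_pos[of n m] by linarith

lemma no_point_between:
  assumes "n < k"
  shows "{pt m j n<..<pt m j (Suc n)} \<inter> X_points p k m = {}"
proof -
  have False if x: "x \<in> X_points p k m" "pt m j n < x" "x < pt m j (Suc n)" for x
  proof -
    obtain j' n' where x': "x = pt m j' n'" "n' < k" using X_points_cases_less[OF x(1)] .
    then have 1: "j < j' \<or> (j = j' \<and> n < n')"
      using x pt_less_iff assms by simp
    show False
    proof (cases "Suc n < k")
      case True
      then have "j' < j \<or> (j = j' \<and> n' < Suc n)" using x x' pt_less_iff by auto
      then show False using 1 by linarith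
    next
      case False
      then have "Suc n = k" using assms by simp
      then have "j' < j + 1 \<or> (j' = j + 1 \<and> n' < 0)"
        using x x' pt_less_iff[of n' 0] pt_wrap[of m j] k_ge2 by auto
      then show False using 1 x'(2) \<open>Suc n = k\<close> by linarith
    qed
  qed
  then show ?thesis by auto
qed

lemma lifted_arcs_eq: "lifted_arcs p k m = {(pt m j n, pt m j (Suc n)) | j n. n < k}"
proof (intro subset_antisym subsetI)
  fix e
  assume "e \<in> lifted_arcs p k m"
  then obtain x y where e: "e = (x, y)" and x: "x \<in> X_points p k m" and y: "y \<in> X_points p k m"
    and "x < y" and empty: "{x<..<y} \<inter> X_points p k m = {}"
    by (auto simp: lifted_arcs_def)
  obtain j n where jn: "x = pt m j n" "n < k" using X_points_cases_less[OF x] .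
  have "pt m j (Suc n) \<in> X_points p k m" using jn by (intro pt_in_X) simp
  then have "y \<le> pt m j (Suc n)"
    using empty pt_less_Suc[of m j n] jn by force
  moreover have "pt m j (Suc n) \<le> y"
    using no_point_between[OF jn(2), of m j] y \<open>x < y\<close> jn(1) by force
  ultimately show "e \<in> {(pt m j n, pt m j (Suc n)) | j n. n < k}"
    using e jn by auto
next
  fix e
  assume "e \<in> {(pt m j n, pt m j (Suc n)) | j n. n < k}"
  then show "e \<in> lifted_arcs p k m"
    using no_point_between pt_less_Suc
    by (auto simp: lifted_arcs_def intro: pt_in_X)
qed

text \<open>The lengths increase strictly with \<open>n\<close>, so the length of an edge determines
  its type.\<close>

lemma of_type_arc: "of_type p k m n' (pt m j n, pt m j (Suc n)) \<longleftrightarrow> n' = n"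
proof -
  have "\<bar>pt m j n - pt m j (Suc n)\<bar> = real p ^ n * (real p - 1) / (real p ^ m * Q)"
    using pt_diff[of m j n] length_pos[of n m] by linarith
  moreover have "real p ^ n * (real p - 1) / (real p ^ m * Q)
      = real p ^ n' * (real p - 1) / (real p ^ m * Q) \<longleftrightarrow> n = n'"
    using p_gt1 Q_pos by (auto simp: power_inject_exp)
  ultimately show ?thesis by (auto simp: of_type_def Q_def)
qed

text \<open>Fixes one representative per edge: left endpoints in [0, 1) mean block numbers
  \<open>0..p^m - 1\<close>, which leaves \<open>p^m\<close> edges of each type.\<close>

lemma pt_unit_iff:
  assumes "n < k"
  shows "0 \<le> pt m j n \<and> pt m j n < 1 \<longleftrightarrow> 0 \<le> j \<and> j < int p ^ m"
proof -
  have "0 \<le> pt m j n \<longleftrightarrow> 0 \<le> of_int j + real p ^ n / Q"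
    unfolding pt_def using zero_less_power[OF p_pos, of m] by (simp add: zero_le_divide_iff not_le[symmetric])
  also have "\<dots> \<longleftrightarrow> 0 \<le> j"
    using power_over_Q_pos[of n] power_over_Q_lt1[OF assms] by (auto; linarith)
  finally have 1: "0 \<le> pt m j n \<longleftrightarrow> 0 \<le> j" .
  have "pt m j n < 1 \<longleftrightarrow> of_int j + real p ^ n / Q < of_int (int p ^ m)"
    unfolding pt_def using p_pos by simp
  also have "\<dots> \<longleftrightarrow> j < int p ^ m"
    using power_over_Q_pos[of n] power_over_Q_lt1[OF assms] by linarith
  finally show ?thesis using 1 by blast
qed

lemma edges_of_type:
  assumes "n < k"
  shows "{e \<in> X_edges p k m. of_type p k m n e}
    = (\<lambda>j. (pt m (int j) n, pt m (int j) (Suc n))) ` {..<p ^ m}"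
proof (intro subset_antisym subsetI)
  fix e
  assume "e \<in> {e \<in> X_edges p k m. of_type p k m n e}"
  then obtain j where e: "e = (pt m j n, pt m j (Suc n))" and "0 \<le> pt m j n \<and> pt m j n < 1"
    by (auto simp: X_edges_def lifted_arcs_eq of_type_arc)
  then have "0 \<le> j" "j < int p ^ m"
    using pt_unit_iff[OF assms] by blast+
  then have "nat j < p ^ m" "e = (pt m (int (nat j)) n, pt m (int (nat j)) (Suc n))"
    using e by (auto simp: nat_less_iff)
  then show "e \<in> (\<lambda>j. (pt m (int j) n, pt m (int j) (Suc n))) ` {..<p ^ m}"
    by blast
next
  fix e
  assume "e \<in> (\<lambda>j. (pt m (int j) n, pt m (int j) (Suc n))) ` {..<p ^ m}"
  then obtain j where j: "j < p ^ m" and e: "e = (pt m (int j) n, pt m (int j) (Suc n))" by auto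
  have "int j < int p ^ m" using j by (metis of_nat_less_iff of_nat_power)
  then show "e \<in> {e \<in> X_edges p k m. of_type p k m n e}"
    using assms e pt_unit_iff[OF assms, of m "int j"]
    by (auto simp: X_edges_def lifted_arcs_eq of_type_arc)
qed

definition inv_length :: "nat \<Rightarrow> nat \<Rightarrow> real" where
  "inv_length m n = real p ^ m * Q / (real p ^ n * (real p - 1))"

lemma inv_length_pos: "0 < inv_length m n"
  using p_gt1 Q_pos by (simp add: inv_length_def)

lemma E_type_eq:
  assumes "n < k"
  shows "E_type p k m n u
    = (\<Sum>j<p ^ m. (u (pt m (int j) (Suc n)) - u (pt m (int j) n))\<^sup>2) * inv_length m n"
proof -
  have inj: "inj_on (\<lambda>j. (pt m (int j) n, pt m (int j) (Suc n))) {..<p ^ m}"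
    using pt_eq_iff[OF assms assms] by (auto simp: inj_on_def)
  have "\<bar>pt m j n - pt m j (Suc n)\<bar> = 1 / inv_length m n" for j
    using pt_diff[of m j n] length_pos[of n m] unfolding inv_length_def by simp
  then show ?thesis
    unfolding E_type_def edges_of_type[OF assms]
    by (simp add: sum.reindex[OF inj] power2_commute sum_distrib_right)
qed

subsection \<open>Kneading sequences of the graph points\<close>

text \<open>The \<open>c\<close> for which \<open>p^j t\<close> lies in the left-open interval from
  \<open>1/Q + c\<close> to \<open>1/Q + c + 1\<close>. As \<open>p * theta = 1/Q\<close>, the value
  of \<open>cell (Suc j)\<close> modulo \<open>p\<close> is digit \<open>j\<close> of the kneading
  sequence. The ceiling minus 1 places the right end, not the left end, in the interval.\<close>

definition cell :: "nat \<Rightarrow> real \<Rightarrow> int" where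
  "cell j t = \<lceil>real p ^ j * t - 1 / Q\<rceil> - 1"

lemma cell_eqI: "of_int c < real p ^ j * t - 1 / Q \<Longrightarrow> real p ^ j * t - 1 / Q \<le> of_int c + 1 \<Longrightarrow> cell j t = c"
  unfolding cell_def by linarith

lemma cell_less: "of_int (cell j t) < real p ^ j * t - 1 / Q"
  and cell_le: "real p ^ j * t - 1 / Q \<le> of_int (cell j t) + 1"
  unfolding cell_def by linarith+

lemma cell_add:
  assumes "real p ^ j * s = real p ^ j * t + of_int z"
  shows "cell j s = cell j t + z"
  using assms unfolding cell_def by linarith

lemma cell_translate: "cell j (t + of_int z) = cell j t + int p ^ j * z"
  by (rule cell_add) (simp add: algebra_simps)

lemma cell_scale: "cell j (real p * t) = cell (Suc j) t"
  by (simp add: cell_def algebra_simps)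

lemma theta_eq: "theta p k = 1 / Q / real p"
  by (simp add: theta_def Q_def)

text \<open>Multiplication by \<open>p\<close> stretches the arc to a unit interval starting at
  \<open>1/Q + n\<close>; integer translates of the arc shift the cell by multiples of
  \<open>p\<close>.\<close>

lemma part_arc_iff:
  assumes "n < p"
  shows "t \<in> part_arc p k n \<longleftrightarrow> cell 1 t mod int p = int n"
proof
  assume "t \<in> part_arc p k n"
  then obtain s where s: "theta p k + real n / real p < s" "s \<le> theta p k + real (n + 1) / real p"
    and "t - s \<in> \<int>"
    unfolding part_arc_def by auto
  then obtain z where "t - s = of_int z" by (auto elim: Ints_cases)
  then have z: "t = s + of_int z" by simp
  have "cell 1 s = int n"
  proof (rule cell_eqI)
    have "real p * (theta p k + real n / real p) < real p * s"
      using s(1) p_pos by simp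
    then show "real_of_int (int n) < real p ^ 1 * s - 1 / Q"
      using p_pos by (simp add: theta_eq algebra_simps)
    have "real p * s \<le> real p * (theta p k + real (n + 1) / real p)"
      using s(2) p_pos by (intro mult_left_mono) auto
    also have "\<dots> = 1 / Q + real n + 1"
      using p_pos Q_pos by (simp add: theta_eq field_simps)
    finally show "real p ^ 1 * s - 1 / Q \<le> real_of_int (int n) + 1"
      by simp
  qed
  then show "cell 1 t mod int p = int n"
    using assms cell_translate[of 1 s z] by (simp add: z)
next
  assume n: "cell 1 t mod int p = int n"
  define z where "z = cell 1 t div int p"
  have c: "cell 1 t = int n + int p * z"
    using mod_mult_div_eq[of "cell 1 t" "int p"] unfolding n z_def by simp
  then have "of_int (int n) + real p * of_int z < real p * t - 1 / Q"
    "real p * t - 1 / Q \<le> of_int (int n) + real p * of_int z + 1"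
    using cell_less[of 1 t] cell_le[of 1 t] by simp_all
  then have "theta p k + real n / real p < t - of_int z"
    "t - of_int z \<le> theta p k + real (n + 1) / real p"
    using p_pos by (simp_all add: theta_eq field_simps)
  then show "t \<in> part_arc p k n"
    unfolding part_arc_def by (auto intro!: bexI[of _ "t - of_int z"])
qed

text \<open>Passing to the fractional part changes \<open>cell 1\<close> by a multiple of
  \<open>p\<close>, so iterating the circle map may be replaced by multiplying a real representative
  by \<open>p^j\<close>.\<close>

lemma kneading_eq: "kneading p k t j = nat (cell (Suc j) t mod int p)"
proof -
  have "frac (real p ^ j * t) = real p ^ j * t + of_int (- \<lfloor>real p ^ j * t\<rfloor>)"
    by (simp add: frac_def)
  then have "cell 1 (frac (real p ^ j * t)) = cell 1 (real p ^ j * t) - int p * \<lfloor>real p ^ j * t\<rfloor>"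
    using cell_translate[of 1 "real p ^ j * t" "- \<lfloor>real p ^ j * t\<rfloor>"] by simp
  moreover have "cell 1 (real p ^ j * t) = cell (Suc j) t"
    by (simp add: cell_def algebra_simps)
  ultimately have "cell 1 (frac (real p ^ j * t)) mod int p = cell (Suc j) t mod int p"
    by (simp add: mod_diff_eq[symmetric])
  then have "kneading p k t j = (THE n. n < p \<and> cell (Suc j) t mod int p = int n)"
    unfolding kneading_def by (simp add: part_arc_iff cong: conj_cong)
  also have "\<dots> = nat (cell (Suc j) t mod int p)"
    using p_ge2 by (intro the_equality) (auto simp: nat_less_iff)
  finally show ?thesis .
qed

lemma identified_iff:
  "identified p k s t \<longleftrightarrow> (\<forall>j. cell (Suc j) s mod int p = cell (Suc j) t mod int p)"
proof -
  have "0 < int p" using p_ge2 by simp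
  then show ?thesis
    unfolding identified_def fun_eq_iff kneading_eq by (simp add: eq_nat_nat_iff)
qed

lemma identified_trans: "identified p k r s \<Longrightarrow> identified p k s t \<Longrightarrow> identified p k r t"
  by (simp add: identified_def)

lemma identified_translate: "identified p k (t + of_int z) t"
  unfolding identified_iff cell_translate by (simp add: mult.assoc)

lemma identified_scale: "identified p k s t \<Longrightarrow> identified p k (real p * s) (real p * t)"
  unfolding identified_iff cell_scale by blast

text \<open>Descent on \<open>m\<close>: an integer difference \<open>z\<close> after scaling by
  \<open>p^(m+1)\<close> is also the difference of the two cells there, and equal digits force
  \<open>p\<close> to divide \<open>z\<close>, so one factor \<open>p\<close> can be
  cancelled.\<close>

lemma identified_imp_same_point:
  assumes "identified p k s t" "real p ^ m * s - real p ^ m * t \<in> \<int>"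
  shows "s - t \<in> \<int>"
  using assms(2)
proof (induction m)
  case (Suc m)
  from Suc.prems obtain z where "real p ^ Suc m * s - real p ^ Suc m * t = of_int z"
    by (auto elim: Ints_cases simp del: power_Suc)
  then have z: "real p ^ Suc m * s = real p ^ Suc m * t + of_int z" by linarith
  have "cell (Suc m) s = cell (Suc m) t + z"
    by (rule cell_add[OF z])
  moreover have "cell (Suc m) s mod int p = cell (Suc m) t mod int p"
    using assms(1) identified_iff by blast
  ultimately have "int p dvd z"
    by (metis add_diff_cancel_left' mod_eq_dvd_iff)
  then obtain y where y: "z = int p * y" ..
  have "real p * (real p ^ m * s - real p ^ m * t) = real p * of_int y"
    using z y by (simp add: algebra_simps)
  then have "real p ^ m * s - real p ^ m * t = of_int y"
    using p_pos by simp
  then show ?case using Suc.IH by simp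
qed simp

text \<open>The index range \<open>1..k\<close> is matched to the left-open cells: all offsets of a
  block lie in one cell, so at level \<open>m\<close> the cell is the block number.\<close>

lemma power_over_Q_bounds:
  assumes "1 \<le> n" "n \<le> k"
  shows "1 / Q < real p ^ n / Q" "real p ^ n / Q \<le> 1 + 1 / Q"
  using power_over_Q_strict_mono[of 0 n] power_over_Q_mono[OF assms(2)] power_k_over_Q assms
  by simp_all

lemma cell_pt:
  assumes "1 \<le> n" "n \<le> k"
  shows "cell m (pt m j n) = j"
proof -
  have "real p ^ m * pt m j n = of_int j + real p ^ n / Q"
    using p_pos by (simp add: pt_def)
  then show ?thesis
    using power_over_Q_bounds[OF assms] by (intro cell_eqI) linarith+
qed

text \<open>Modulo 1, multiplication by \<open>p\<close> permutes the offsets \<open>p^a / Q\<close>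
  cyclically, since \<open>p^k / Q = 1 + 1/Q\<close>. When the cycle closes, the integer split off
  is \<open>p\<close>, hence a multiple of \<open>p\<close> again.\<close>

lemma power_over_Q_reduce:
  "\<exists>J a. 1 \<le> a \<and> a \<le> k \<and> real p ^ Suc e / Q = of_int (int p * J) + real p ^ a / Q"
proof (induction e)
  case 0
  show ?case using k_ge2 by (intro exI[of _ 0] exI[of _ 1]) simp
next
  case (Suc e)
  then obtain J a where a: "1 \<le> a" "a \<le> k"
    and eq: "real p ^ Suc e / Q = of_int (int p * J) + real p ^ a / Q" by blast
  have "real p ^ Suc (Suc e) / Q = real p * (real p ^ Suc e / Q)" by simp
  also have "\<dots> = of_int (int p * (int p * J)) + real p * (real p ^ a / Q)"
    unfolding eq by (simp add: algebra_simps)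
  finally have eq': "real p ^ Suc (Suc e) / Q = of_int (int p * (int p * J)) + real p * (real p ^ a / Q)" .
  show ?case
  proof (cases "a = k")
    case True
    then have "real p ^ Suc (Suc e) / Q = of_int (int p * (int p * J + 1)) + real p ^ 1 / Q"
      unfolding eq' using power_k_over_Q by (simp add: algebra_simps)
    then show ?thesis using k_ge2 by (intro exI[of _ "int p * J + 1"] exI[of _ 1]) simp
  next
    case False
    then show ?thesis
      using a eq' by (intro exI[of _ "int p * J"] exI[of _ "Suc a"]) simp
  qed
qed

text \<open>After \<open>m\<close> steps a graph point sits on the periodic orbit of the offsets,
  all of whose points have digit 0. Hence its kneading digits from position \<open>m\<close> on are
  0.\<close>

lemma cell_beyond:
  assumes "1 \<le> n" "n \<le> k"
  shows "int p dvd cell (Suc i + m) (pt m j n)"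
proof -
  obtain J a where a: "1 \<le> a" "a \<le> k"
    and eq: "real p ^ Suc (i + n) / Q = of_int (int p * J) + real p ^ a / Q"
    using power_over_Q_reduce by blast
  have "real p ^ (Suc i + m) * pt m j n = real p ^ Suc i * of_int j + real p ^ Suc (i + n) / Q"
    using p_pos by (simp add: pt_def power_add field_simps)
  also have "\<dots> = of_int (int p * (int p ^ i * j + J)) + real p ^ a / Q"
    unfolding eq by (simp add: algebra_simps)
  finally have "cell (Suc i + m) (pt m j n) = int p * (int p ^ i * j + J)"
    using power_over_Q_bounds[OF a] by (intro cell_eqI) linarith+
  then show ?thesis by simp
qed

text \<open>Comparing with the lower end of the cell of one point is enough; exchanging
  \<open>n\<close> and \<open>n'\<close> then gives equality of the cells.\<close>

lemma cell_block_le: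
  assumes "\<not> int p dvd l" and n: "1 \<le> n" "n \<le> k" and n': "1 \<le> n'" "n' \<le> k"
  shows "cell j (pt (Suc e + j) l n) \<le> cell j (pt (Suc e + j) l n')"
proof -
  define N where "N = cell j (pt (Suc e + j) l n)"
  obtain J a where a: "1 \<le> a" "a \<le> k"
    and eq: "real p ^ Suc e / Q = of_int (int p * J) + real p ^ a / Q"
    using power_over_Q_reduce by blast
  \<comment> \<open>The lower end of cell \<open>N\<close> at level \<open>j\<close> is the point
    \<open>pt (Suc e + j) M a\<close>, in a block whose number is divisible by
    \<open>p\<close>.\<close>
  define M where "M = int p * (int p ^ e * N + J)"
  have above: "of_int N < real p ^ j * pt (Suc e + j) l i - 1 / Q
    \<longleftrightarrow> of_int M + real p ^ a / Q < of_int l + real p ^ i / Q" for i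
  proof -
    have "real p ^ j * pt (Suc e + j) l i = (of_int l + real p ^ i / Q) / real p ^ Suc e"
      using p_pos by (simp add: pt_def power_add field_simps)
    then have "of_int N < real p ^ j * pt (Suc e + j) l i - 1 / Q
        \<longleftrightarrow> of_int N + 1 / Q < (of_int l + real p ^ i / Q) / real p ^ Suc e"
      by linarith
    also have "\<dots> \<longleftrightarrow> (of_int N + 1 / Q) * real p ^ Suc e < of_int l + real p ^ i / Q"
      using p_pos by (subst pos_less_divide_eq) auto
    also have "(of_int N + 1 / Q) * real p ^ Suc e = of_int N * real p ^ Suc e + real p ^ Suc e / Q"
      by (simp add: algebra_simps)
    also have "\<dots> = of_int M + real p ^ a / Q"
      unfolding eq M_def by (simp add: algebra_simps)
    finally show ?thesis .
  qed
  have "M \<noteq> l" using assms(1) unfolding M_def by auto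
  moreover have "of_int M + real p ^ a / Q < of_int l + real p ^ n / Q"
    using above cell_less N_def by blast
  then have "M < l + 1"
    using power_over_Q_bounds[OF a] power_over_Q_bounds[OF n] by linarith
  \<comment> \<open>Block \<open>M\<close> is a different block, so it precedes block
    \<open>l\<close> entirely, and the strict inequality carries over to every point of block
    \<open>l\<close>.\<close>
  ultimately have "M + 1 \<le> l" by simp
  then have "of_int M + 1 \<le> (of_int l :: real)" by linarith
  then have "of_int M + real p ^ a / Q < of_int l + real p ^ n' / Q"
    using power_over_Q_bounds[OF a] power_over_Q_bounds[OF n'] by linarith
  then have "of_int N < real p ^ j * pt (Suc e + j) l n' - 1 / Q"
    using above by blast
  then show ?thesis
    using cell_le[of j "pt (Suc e + j) l n'"] unfolding N_def by linarith
qed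

text \<open>The left-open boundary points of the cylinder sets lie inside blocks whose number is
  divisible by \<open>p\<close>, so no cylinder set separates the points of any other block.\<close>

lemma identified_block:
  assumes "\<not> int p dvd l" and n: "1 \<le> n" "n \<le> k" and n': "1 \<le> n'" "n' \<le> k"
  shows "identified p k (pt m l n) (pt m l n')"
  unfolding identified_iff
proof
  fix j
  consider "m < Suc j" | "m = Suc j" | "Suc j < m" by linarith
  then show "cell (Suc j) (pt m l n) mod int p = cell (Suc j) (pt m l n') mod int p"
  proof cases
    case 1
    then have "Suc j = Suc (j - m) + m" by simp
    then show ?thesis
      using cell_beyond[OF n, of "j - m" m l] cell_beyond[OF n', of "j - m" m l] by simp
  next
    case 2
    then show ?thesis using cell_pt n n' by simp
  next
    case 3
    define e where "e = m - Suc (Suc j)"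
    have "m = Suc e + Suc j" using 3 by (simp add: e_def)
    then show ?thesis
      using cell_block_le[OF assms(1) n n', of "Suc j" e] cell_block_le[OF assms(1) n' n, of "Suc j" e]
      by simp
  qed
qed

text \<open>Converse of \<open>identified_block\<close>: different new blocks are different vertices
  up to integer translation. Moving both points to the same index makes their scaled difference an
  integer.\<close>

lemma identified_block_number:
  assumes "identified p k (pt (Suc m) l n) (pt (Suc m) l' n')"
    and n: "1 \<le> n" "n \<le> k" and n': "1 \<le> n'" "n' \<le> k"
  shows "l mod int p = l' mod int p"
    and "\<not> int p dvd l \<Longrightarrow> \<exists>z. l = l' + int p ^ Suc m * z"
proof -
  show mod_eq: "l mod int p = l' mod int p"
    using assms(1) cell_pt[OF n] cell_pt[OF n'] unfolding identified_iff by metis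
  assume "\<not> int p dvd l"
  then have same: "identified p k (pt (Suc m) l n') (pt (Suc m) l' n')"
    using identified_block[of l n' n] identified_trans assms by blast
  have scaled: "real p ^ Suc m * pt (Suc m) i n' = of_int i + real p ^ n' / Q" for i
    using p_pos by (simp add: pt_def)
  have "real p ^ Suc m * pt (Suc m) l n' - real p ^ Suc m * pt (Suc m) l' n' = of_int (l - l')"
    unfolding scaled by simp
  then have "pt (Suc m) l n' - pt (Suc m) l' n' \<in> \<int>"
    by (intro identified_imp_same_point[OF same, of "Suc m"]) (simp only: Ints_of_int)
  then obtain z where "pt (Suc m) l n' - pt (Suc m) l' n' = of_int z" by (auto elim: Ints_cases)
  then have "pt (Suc m) l n' = pt (Suc m) (l' + int p ^ Suc m * z) n'"
    using pt_translate[of "Suc m" l' z n'] by linarith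
  then have "real_of_int l = of_int (l' + int p ^ Suc m * z)"
    using scaled[of l] scaled[of "l' + int p ^ Suc m * z"] by (simp only: add_right_cancel)
  then have "l = l' + int p ^ Suc m * z" by (simp only: of_int_eq_iff)
  then show "\<exists>z. l = l' + int p ^ Suc m * z" ..
qed

lemma respects_onD: "respects_on p k S u \<Longrightarrow> s \<in> S \<Longrightarrow> t \<in> S \<Longrightarrow> identified p k s t \<Longrightarrow> u s = u t"
  unfolding respects_on_def by blast

lemma respects_periodic:
  assumes "respects_on p k (X_points p k m) u" "n \<le> k"
  shows "u (pt m (j + int p ^ m * z) n) = u (pt m j n)"
  using assms by (intro respects_onD[OF assms(1)] pt_in_X) (auto simp: pt_translate identified_translate)

lemma respects_periodic_mod:
  assumes "respects_on p k (X_points p k m) u" "n \<le> k"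
  shows "u (pt m (j mod int p ^ m) n) = u (pt m j n)"
  using respects_periodic[OF assms, of "j mod int p ^ m" "j div int p ^ m"] by simp

lemma X_points_mono_Suc: "X_points p k m \<subseteq> X_points p k (Suc m)"
proof
  fix x
  assume "x \<in> X_points p k m"
  then obtain j n where "x = pt m j n" "n < k" by (rule X_points_cases_less)
  then show "x \<in> X_points p k (Suc m)" by (metis Suc_leI pt_in_X pt_refine)
qed

text \<open>Refinement sends \<open>pt m l n'\<close> to index \<open>Suc n'\<close> of block
  \<open>p * l\<close>, and the block number of a point is unique because it is its cell.\<close>

lemma X_points_Suc_iff:
  assumes "1 \<le> n" "n \<le> k"
  shows "pt (Suc m) j n \<in> X_points p k m \<longleftrightarrow> int p dvd j"
proof
  assume "int p dvd j"
  then obtain l where "j = int p * l" ..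
  then show "pt (Suc m) j n \<in> X_points p k m"
    using assms pt_refine[of m l "n - 1"] by (simp add: pt_in_X)
next
  assume "pt (Suc m) j n \<in> X_points p k m"
  then obtain l n' where l: "pt (Suc m) j n = pt m l n'" "n' < k"
    by (rule X_points_cases_less)
  then have "pt (Suc m) j n = pt (Suc m) (int p * l) (Suc n')" by (simp add: pt_refine)
  then have "j = int p * l"
    using cell_pt[OF assms, of "Suc m" j] cell_pt[of "Suc n'" "Suc m" "int p * l"] l(2) by simp
  then show "int p dvd j" by simp
qed

subsection \<open>Harmonic extension\<close>

abbreviation "X m \<equiv> X_points p k m"

lemma extensionD:
  assumes "extension p k (Suc m) u w"
  shows "respects_on p k (X (Suc m)) w"
    and "n \<le> k \<Longrightarrow> w (pt (Suc m) (int p * j) (Suc n)) = u (pt m j n)"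
  using assms unfolding extension_def by (auto simp: pt_refine pt_in_X)

lemma extension_block:
  assumes "extension p k (Suc m) u w" "\<not> int p dvd j" "1 \<le> n" "n \<le> k" "1 \<le> n'" "n' \<le> k"
  shows "w (pt (Suc m) j n) = w (pt (Suc m) j n')"
  using assms by (intro respects_onD[OF extensionD(1)[OF assms(1)]] pt_in_X identified_block)

lemma not_dvd_block: "0 < i \<Longrightarrow> i < p \<Longrightarrow> \<not> int p dvd int p * L + int i"
  by (simp add: dvd_add_right_iff) (meson nat_dvd_not_less)

text \<open>Among \<open>p\<close> consecutive blocks only the first is old; in the others the edges
  of positive type are loops. Raising both the level and the type by one leaves the edge length
  unchanged.\<close>

lemma E_type_extension_Suc:
  assumes ext: "extension p k (Suc m) u w" and n: "Suc n < k"
  shows "E_type p k (Suc m) (Suc n) w = E_type p k m n u"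
proof -
  let ?g = "\<lambda>j. (w (pt (Suc m) (int j) (Suc (Suc n))) - w (pt (Suc m) (int j) (Suc n)))\<^sup>2"
  have "(\<Sum>j<p ^ Suc m. ?g j) = (\<Sum>L<p ^ m. \<Sum>i<p. ?g (p * L + i))"
    using sum_blocks[of ?g "p ^ m" p] by (simp add: mult.commute)
  also have "\<dots> = (\<Sum>L<p ^ m. (u (pt m (int L) (Suc n)) - u (pt m (int L) n))\<^sup>2)"
  proof (rule sum.cong[OF refl])
    fix L
    have "(\<Sum>i<p. ?g (p * L + i)) = (\<Sum>i\<in>{0}. ?g (p * L + i))"
    proof (rule sum.mono_neutral_right)
      show "\<forall>i\<in>{..<p} - {0}. ?g (p * L + i) = 0"
        using extension_block[OF ext not_dvd_block[of _ "int L"], of _ "Suc (Suc n)" "Suc n"] n by auto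
    qed (use p_ge2 in auto)
    also have "\<dots> = (u (pt m (int L) (Suc n)) - u (pt m (int L) n))\<^sup>2"
      using extensionD(2)[OF ext, of n "int L"] extensionD(2)[OF ext, of "Suc n" "int L"] n by simp
    finally show "(\<Sum>i<p. ?g (p * L + i)) = \<dots>" .
  qed
  finally show ?thesis
    using n p_pos by (simp add: E_type_eq inv_length_def)
qed

text \<open>The value of \<open>w\<close> on block \<open>p L + i\<close>, where block \<open>p L\<close> enters through its last point and block
  \<open>p L + p\<close> through its first: the points of these two blocks need not be identified.\<close>

definition chain :: "(real \<Rightarrow> real) \<Rightarrow> nat \<Rightarrow> nat \<Rightarrow> nat \<Rightarrow> real" where
  "chain w m L i =
     (if i = 0 then w (pt (Suc m) (int (p * L)) k) else w (pt (Suc m) (int (p * L + i)) 1))"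

definition jump :: "(real \<Rightarrow> real) \<Rightarrow> nat \<Rightarrow> nat \<Rightarrow> real" where
  "jump u m L = u (pt m (int L) k) - u (pt m (int L) (k - 1))"

text \<open>The type 0 energy of an extension in excess of its minimum. No weights enter.\<close>

definition defect :: "(real \<Rightarrow> real) \<Rightarrow> (real \<Rightarrow> real) \<Rightarrow> nat \<Rightarrow> real" where
  "defect u w m =
     inv_length (Suc m) 0 * (\<Sum>L<p ^ m. \<Sum>i<p. (chain w m L (Suc i) - chain w m L i - jump u m L / real p)\<^sup>2)"

lemma pt_refine_last: "pt (Suc m) (int p * (j + 1)) 1 = pt m j k"
  using pt_refine[of m "j + 1" 0] pt_wrap[of m j] by simp

lemma pt_refine_k: "pt (Suc m) (int p * j) k = pt m j (k - 1)"
  using pt_refine[of m j "k - 1"] k_ge2 by simp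

lemma chain_ends:
  assumes "extension p k (Suc m) u w"
  shows "chain w m L 0 = u (pt m (int L) (k - 1))" "chain w m L p = u (pt m (int L) k)"
proof -
  show "chain w m L 0 = u (pt m (int L) (k - 1))"
    using extensionD(2)[OF assms, of "k - 1" "int L"] k_ge2 by (simp add: chain_def)
  have "chain w m L p = w (pt (Suc m) (int p * (int L + 1)) 1)"
    using p_ge2 by (simp add: chain_def algebra_simps)
  then show "chain w m L p = u (pt m (int L) k)"
    using extensionD(2)[OF assms, of 0 "int L + 1"] by (simp add: pt_wrap)
qed

lemma chain_eq:
  assumes "extension p k (Suc m) u w" "i < p"
  shows "chain w m L i = w (pt (Suc m) (int (p * L + i)) k)"
  using extension_block[OF assms(1) not_dvd_block[of i "int L"], of k 1] assms(2) k_ge2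
  by (simp add: chain_def)

lemma E_type_extension_0:
  assumes ext: "extension p k (Suc m) u w"
  shows "E_type p k (Suc m) 0 w = real p ^ (k - 1) * E_type p k m (k - 1) u + defect u w m"
proof -
  let ?g = "\<lambda>j. (w (pt (Suc m) (int j) 1) - w (pt (Suc m) (int j) 0))\<^sup>2"
  note resp = extensionD(1)[OF ext]
  \<comment> \<open>The type 0 edge with number \<open>j\<close> joins block \<open>j - 1\<close> to
    block \<open>j\<close>, so chain \<open>L\<close> uses the numbers \<open>p * L + 1\<close> to
    \<open>p * L + p\<close>. Periodicity allows the sum to be shifted by one to fit these
    ranges.\<close>
  have "?g (p ^ Suc m) = ?g 0"
    using respects_periodic[OF resp, of 1 0 1] respects_periodic[OF resp, of 0 0 1] k_ge2 by simp
  then have "(\<Sum>j<p ^ Suc m. ?g j) = (\<Sum>j<p ^ Suc m. ?g (Suc j))"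
    by (rule sum_shift_periodic[symmetric])
  also have "\<dots> = (\<Sum>L<p ^ m. \<Sum>i<p. ?g (Suc (p * L + i)))"
    using sum_blocks[of "\<lambda>j. ?g (Suc j)" "p ^ m" p] by (simp add: mult.commute)
  also have "\<dots> = (\<Sum>L<p ^ m. \<Sum>i<p. (chain w m L (Suc i) - chain w m L i)\<^sup>2)"
  proof (intro sum.cong refl)
    fix L i
    assume "i \<in> {..<p}"
    then have "chain w m L i = w (pt (Suc m) (int (Suc (p * L + i))) 0)"
      using chain_eq[OF ext] pt_wrap[of "Suc m" "int (p * L + i)"] by (simp add: add.commute)
    then show "?g (Suc (p * L + i)) = (chain w m L (Suc i) - chain w m L i)\<^sup>2"
      by (simp add: chain_def)
  qed
  also have "\<dots> = (\<Sum>L<p ^ m. (jump u m L)\<^sup>2 / real p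
      + (\<Sum>i<p. (chain w m L (Suc i) - chain w m L i - jump u m L / real p)\<^sup>2))"
    using p_ge2 by (subst sum_square_increments) (auto simp: chain_ends[OF ext] jump_def)
  finally have "E_type p k (Suc m) 0 w
      = (\<Sum>L<p ^ m. (jump u m L)\<^sup>2) / real p * inv_length (Suc m) 0 + defect u w m"
    using k_ge2 by (simp add: E_type_eq defect_def sum.distrib sum_divide_distrib algebra_simps)
  \<comment> \<open>Here \<open>inv_length (Suc m) 0 / p = p^(k-1) * inv_length m (k-1)\<close>,
    which is the corner entry of \<open>M\<close>.\<close>
  also have "(\<Sum>L<p ^ m. (jump u m L)\<^sup>2) / real p * inv_length (Suc m) 0
      = real p ^ (k - 1) * E_type p k m (k - 1) u"
    using k_ge2 p_gt1 by (simp add: E_type_eq jump_def inv_length_def)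
  finally show ?thesis .
qed

lemma defect_nonneg: "0 \<le> defect u w m"
  unfolding defect_def using inv_length_pos[of "Suc m" 0]
  by (intro mult_nonneg_nonneg sum_nonneg) auto

lemma defect_eq_0_iff:
  "defect u w m = 0 \<longleftrightarrow>
     (\<forall>L<p ^ m. \<forall>i<p. chain w m L (Suc i) - chain w m L i = jump u m L / real p)"
proof -
  have "defect u w m = 0 \<longleftrightarrow>
      (\<Sum>L<p ^ m. \<Sum>i<p. (chain w m L (Suc i) - chain w m L i - jump u m L / real p)\<^sup>2) = 0"
    using inv_length_pos[of "Suc m" 0] by (simp add: defect_def)
  also have "\<dots> \<longleftrightarrow> (\<forall>L<p ^ m. (\<Sum>i<p. (chain w m L (Suc i) - chain w m L i - jump u m L / real p)\<^sup>2) = 0)"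
    by (subst sum_nonneg_eq_0_iff) (auto intro: sum_nonneg)
  also have "\<dots> \<longleftrightarrow> (\<forall>L<p ^ m. \<forall>i<p. chain w m L (Suc i) - chain w m L i = jump u m L / real p)"
    by (subst sum_nonneg_eq_0_iff) auto
  finally show ?thesis .
qed

lemma defect_0_chain:
  assumes ext: "extension p k (Suc m) u w" and "defect u w m = 0" "L < p ^ m" "i \<le> p"
  shows "chain w m L i = u (pt m (int L) (k - 1)) + real i * (jump u m L / real p)"
  using assms(4)
proof (induction i)
  case 0
  then show ?case using chain_ends[OF ext] by simp
next
  case (Suc i)
  have "chain w m L (Suc i) - chain w m L i = jump u m L / real p"
    using assms(2,3) Suc.prems unfolding defect_eq_0_iff by simp
  moreover have "chain w m L i = u (pt m (int L) (k - 1)) + real i * (jump u m L / real p)"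
    using Suc by simp
  ultimately show ?case by (simp add: algebra_simps add_divide_distrib)
qed

text \<open>All terms but the last are determined by \<open>u\<close>, so minimizing over extensions
  means minimizing \<open>defect\<close>.\<close>

lemma E_weighted_extension:
  assumes "extension p k (Suc m) u w"
  shows "E_weighted p k b (Suc m) w
    = b 0 * real p ^ (k - 1) * E_type p k m (k - 1) u + (\<Sum>n<k - 1. b (Suc n) * E_type p k m n u)
      + b 0 * defect u w m"
proof -
  have "E_weighted p k b (Suc m) w
      = b 0 * E_type p k (Suc m) 0 w + (\<Sum>n<k - 1. b (Suc n) * E_type p k (Suc m) (Suc n) w)"
    unfolding E_weighted_def using k_ge2 sum.lessThan_Suc_shift[of "\<lambda>n. b n * E_type p k (Suc m) n w" "k - 1"]
    by simp
  also have "(\<Sum>n<k - 1. b (Suc n) * E_type p k (Suc m) (Suc n) w) = (\<Sum>n<k - 1. b (Suc n) * E_type p k m n u)"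
    using E_type_extension_Suc[OF assms] by (intro sum.cong) auto
  finally show ?thesis
    by (simp add: E_type_extension_0[OF assms] algebra_simps)
qed

lemma minimal_defect_imp_eq:
  assumes ext: "extension p k (Suc m) u w" "extension p k (Suc m) u w'"
    and "defect u w m = 0" "defect u w' m = 0" and "x \<in> X (Suc m)"
  shows "w' x = w x"
proof -
  obtain j n where x: "x = pt (Suc m) j n" and n: "1 \<le> n" "n \<le> k"
    using \<open>x \<in> X (Suc m)\<close> by (rule X_points_cases)
  show ?thesis
  proof (cases "int p dvd j")
    case True
    then have "x \<in> X m" using X_points_Suc_iff[OF n] x by simp
    then show ?thesis using ext by (simp add: extension_def)
  next
    case False
    \<comment> \<open>An integer translation brings the block into the range over which
      \<open>defect\<close> sums.\<close>
    define j' where "j' = nat (j mod int p ^ Suc m)"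
    have pm: "0 < int p ^ Suc m" using p_ge2 by simp
    then have j': "int j' = j mod int p ^ Suc m"
      unfolding j'_def by (metis nat_0_le pos_mod_sign)
    have "int j' < int (p ^ Suc m)" unfolding j' using pm by (metis of_nat_power pos_mod_bound)
    then have "j' < p ^ Suc m" by linarith
    then have L: "j' div p < p ^ m"
      using p_ge2 by (simp add: less_mult_imp_div_less mult.commute)
    have nd: "\<not> int p dvd int j'"
      unfolding j' using False by (simp add: dvd_mod_iff)
    then have pos: "j' mod p \<noteq> 0" by (simp add: mod_eq_0_iff_dvd)
    have x_chain: "v x = chain v m (j' div p) (j' mod p)" if e: "extension p k (Suc m) u v" for v
    proof -
      have "v x = v (pt (Suc m) (int j') n)"
        unfolding x j' using respects_periodic_mod[OF extensionD(1)[OF e] n(2)] by simp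
      also have "\<dots> = v (pt (Suc m) (int j') 1)"
        using k_ge2 by (intro extension_block[OF e nd n]) auto
      also have "\<dots> = chain v m (j' div p) (j' mod p)"
        using pos unfolding chain_def by (simp only: if_False mult_div_mod_eq)
      finally show ?thesis .
    qed
    have "j' mod p \<le> p" using p_ge2 by simp
    then show ?thesis
      using defect_0_chain[OF ext(1) assms(3) L] defect_0_chain[OF ext(2) assms(4) L]
      by (simp only: x_chain[OF ext(1)] x_chain[OF ext(2)])
  qed
qed

text \<open>Closed form of the minimizer. For a graph point the cell is its block number
  \<open>j\<close>; a new block is reached after \<open>j mod p\<close> links of the chain that
  subdivides the edge of type \<open>k - 1\<close> in coarse block \<open>L\<close>.\<close>

definition lin_ext :: "(real \<Rightarrow> real) \<Rightarrow> nat \<Rightarrow> real \<Rightarrow> real" where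
  "lin_ext u m x =
     (let j = cell (Suc m) x; L = j div int p in
      if int p dvd j then u x
      else u (pt m L (k - 1)) + of_int (j mod int p) * ((u (pt m L k) - u (pt m L (k - 1))) / real p))"

text \<open>The formula is well defined on vertices: identified points have block numbers congruent
  modulo \<open>p\<close>, and for new blocks the coarse block is determined up to a translation,
  under which \<open>u\<close> is periodic.\<close>

lemma extension_lin_ext:
  assumes u: "respects_on p k (X m) u"
  shows "extension p k (Suc m) u (lin_ext u m)"
  unfolding extension_def
proof
  show "\<forall>x\<in>X (Suc m - 1). lin_ext u m x = u x"
  proof
    fix x
    assume "x \<in> X (Suc m - 1)"
    then have x: "x \<in> X m" by simp
    then obtain j n where "x = pt (Suc m) j n" and n: "1 \<le> n" "n \<le> k"
      using X_points_mono_Suc X_points_cases by (metis subsetD)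
    then have "int p dvd cell (Suc m) x" using x X_points_Suc_iff cell_pt by metis
    then show "lin_ext u m x = u x" by (simp add: lin_ext_def)
  qed
  show "respects_on p k (X (Suc m)) (lin_ext u m)"
    unfolding respects_on_def
  proof (intro ballI impI)
    fix x y
    assume "x \<in> X (Suc m)" "y \<in> X (Suc m)" and ident: "identified p k x y"
    then obtain j n j' n' where x: "x = pt (Suc m) j n" and n: "1 \<le> n" "n \<le> k"
      and y: "y = pt (Suc m) j' n'" and n': "1 \<le> n'" "n' \<le> k"
      by (metis X_points_cases)
    have cells: "cell (Suc m) x = j" "cell (Suc m) y = j'"
      using x y cell_pt n n' by auto
    have mod_eq: "j mod int p = j' mod int p"
      using identified_block_number(1)[OF _ n n'] ident x y by blast
    show "lin_ext u m x = lin_ext u m y"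
    proof (cases "int p dvd j")
      case True
      then have "int p dvd j'" using mod_eq by (simp add: dvd_eq_mod_eq_0)
      then have "x \<in> X m" "y \<in> X m" using True x y n n' X_points_Suc_iff by auto
      then show ?thesis
        using True \<open>int p dvd j'\<close> respects_onD[OF u _ _ ident] by (simp add: lin_ext_def cells)
    next
      case False
      then have "\<not> int p dvd j'" using mod_eq by (simp add: dvd_eq_mod_eq_0)
      obtain z where "j = j' + int p ^ Suc m * z"
        using identified_block_number(2)[OF _ n n' False] ident x y by blast
      then have "j = j' + int p * (int p ^ m * z)" by simp
      then have "j div int p = j' div int p + int p ^ m * z"
        using p_ge2 by simp
      then have "u (pt m (j div int p) i) = u (pt m (j' div int p) i)" if "i \<le> k" for i
        using respects_periodic[OF u that] by simp
      then show ?thesis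
        using False \<open>\<not> int p dvd j'\<close> mod_eq by (simp add: lin_ext_def cells Let_def)
    qed
  qed
qed

lemma chain_lin_ext:
  assumes u: "respects_on p k (X m) u" and "i \<le> p"
  shows "chain (lin_ext u m) m L i = u (pt m (int L) (k - 1)) + real i * (jump u m L / real p)"
proof -
  note ext = extension_lin_ext[OF u]
  consider "i = 0" | "0 < i" "i < p" | "i = p" using assms(2) by linarith
  then show ?thesis
  proof cases
    case 1
    then show ?thesis using chain_ends[OF ext] by simp
  next
    case 2
    have "cell (Suc m) (pt (Suc m) (int (p * L + i)) 1) = int p * int L + int i"
      using cell_pt k_ge2 by simp
    moreover have "(int p * int L + int i) div int p = int L" "(int p * int L + int i) mod int p = int i"
      using 2 by simp_all
    ultimately show ?thesis
      using 2 not_dvd_block[OF 2, of "int L"] by (simp add: chain_def lin_ext_def jump_def Let_def)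
  next
    case 3
    then show ?thesis using chain_ends[OF ext] p_pos by (simp add: jump_def)
  qed
qed

lemma defect_lin_ext:
  assumes "respects_on p k (X m) u"
  shows "defect u (lin_ext u m) m = 0"
  unfolding defect_eq_0_iff using chain_lin_ext[OF assms]
  by (simp add: ring_distribs add_divide_distrib)

text \<open>The defect enters with the factor \<open>b 0 > 0\<close> and attains its lower bound 0
  at \<open>lin_ext\<close>. The resulting criterion is free of the weights.\<close>

lemma harmonic_iff:
  assumes u: "respects_on p k (X m) u" and b: "positive_weights k b"
  shows "harmonic_extension p k b (Suc m) u w \<longleftrightarrow> extension p k (Suc m) u w \<and> defect u w m = 0"
proof -
  have b0: "0 < b 0" using b k_ge2 by (simp add: positive_weights_def)
  have le: "E_weighted p k b (Suc m) w \<le> E_weighted p k b (Suc m) w' \<longleftrightarrow> defect u w m \<le> defect u w' m"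
    if "extension p k (Suc m) u w" "extension p k (Suc m) u w'" for w w'
    using b0 by (simp add: E_weighted_extension[OF that(1)] E_weighted_extension[OF that(2)])
  show ?thesis
  proof
    assume h: "harmonic_extension p k b (Suc m) u w"
    then have "defect u w m \<le> defect u (lin_ext u m) m"
      using le extension_lin_ext[OF u] unfolding harmonic_extension_def by blast
    then show "extension p k (Suc m) u w \<and> defect u w m = 0"
      using h defect_nonneg[of u w m] defect_lin_ext[OF u] unfolding harmonic_extension_def by simp
  next
    assume "extension p k (Suc m) u w \<and> defect u w m = 0"
    then show "harmonic_extension p k b (Suc m) u w"
      using le defect_nonneg unfolding harmonic_extension_def by simp
  qed
qed

text \<open>\<open>M\<close> is a weighted cyclic shift: each row and each column has a single
  nonzero entry, to which the sum collapses.\<close>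

lemma sum_M_entry_row:
  assumes "n' < k"
  shows "(\<Sum>n<k. M_entry p k n' n * F n) = (if n' = 0 then real p ^ (k - 1) * F (k - 1) else F (n' - 1))"
proof -
  have "M_entry p k n' n * F n = (if n = (if n' = 0 then k - 1 else n' - 1)
      then (if n' = 0 then real p ^ (k - 1) * F (k - 1) else F (n' - 1)) else 0)" if "n < k" for n
    using assms k_ge2 by (auto simp: M_entry_def)
  then have "(\<Sum>n<k. M_entry p k n' n * F n) = (\<Sum>n<k. if n = (if n' = 0 then k - 1 else n' - 1)
      then (if n' = 0 then real p ^ (k - 1) * F (k - 1) else F (n' - 1)) else 0)"
    by (intro sum.cong) auto
  also have "\<dots> = (if n' = 0 then real p ^ (k - 1) * F (k - 1) else F (n' - 1))"
    using assms by simp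
  finally show ?thesis .
qed

lemma sum_M_entry_column:
  assumes "n < k"
  shows "(\<Sum>n'<k. F n' * M_entry p k n' n) = (if n = k - 1 then F 0 * real p ^ (k - 1) else F (Suc n))"
proof -
  have "F n' * M_entry p k n' n = (if n' = (if n = k - 1 then 0 else Suc n)
      then (if n = k - 1 then F 0 * real p ^ (k - 1) else F (Suc n)) else 0)" if "n' < k" for n'
    using that assms k_ge2 by (auto simp: M_entry_def)
  then have "(\<Sum>n'<k. F n' * M_entry p k n' n) = (\<Sum>n'<k. if n' = (if n = k - 1 then 0 else Suc n)
      then (if n = k - 1 then F 0 * real p ^ (k - 1) else F (Suc n)) else 0)"
    by (intro sum.cong) auto
  also have "\<dots> = (if n = k - 1 then F 0 * real p ^ (k - 1) else F (Suc n))"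
    using assms k_ge2 by auto
  finally show ?thesis .
qed

lemma E_type_harmonic:
  assumes "extension p k (Suc m) u w" "defect u w m = 0" "n' < k"
  shows "E_type p k (Suc m) n' w = (\<Sum>n<k. M_entry p k n' n * E_type p k m n u)"
  using assms E_type_extension_0[OF assms(1)] E_type_extension_Suc[OF assms(1)]
  by (cases n') (simp_all add: sum_M_entry_row)

text \<open>At the finer level the edge runs from the last point of block \<open>p L\<close> to the
  first point of block \<open>p L + p\<close>. It thus contains the \<open>p - 1\<close> new blocks
  between them, whose inner edges are loops, and the \<open>p\<close> links.\<close>

lemma harmonic_pieces:
  assumes u: "respects_on p k (X m) u" and ext: "extension p k (Suc m) u w" and "defect u w m = 0"
    and edge: "(x, y) \<in> X_edges p k m" "of_type p k m (k - 1) (x, y)"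
  defines "pieces \<equiv> {(s, t) \<in> lifted_arcs p k (Suc m). {s..t} \<subseteq> {x..y}}"
  shows "card {e \<in> pieces. of_type p k (Suc m) 0 e} = p"
    and "\<forall>(s, t) \<in> pieces. \<not> of_type p k (Suc m) 0 (s, t) \<longrightarrow> identified p k s t"
    and "\<forall>(s, t) \<in> pieces. of_type p k (Suc m) 0 (s, t) \<longrightarrow> w t - w s = 1 / real p * (u y - u x)"
proof -
  have "(x, y) \<in> {e \<in> X_edges p k m. of_type p k m (k - 1) e}" using edge by simp
  then obtain L where L: "L < p ^ m" and x: "x = pt m (int L) (k - 1)" and y: "y = pt m (int L) (Suc (k - 1))"
    using k_ge2 by (subst (asm) edges_of_type) auto
  have y_eq: "y = pt (Suc m) (int (p * L + p)) 1"
    using y k_ge2 pt_refine_last[of m "int L"] by (simp add: algebra_simps)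
  have x_eq: "x = pt (Suc m) (int (p * L) + 1) 0"
    using x pt_refine_k[of m "int L"] pt_wrap[of "Suc m" "int (p * L)"] by simp
  \<comment> \<open>As \<open>y\<close> is itself a graph point, an arc starting before
    \<open>y\<close> cannot pass it, so only the left endpoint has to be located.\<close>
  have piece_iff: "(pt (Suc m) j n, pt (Suc m) j (Suc n)) \<in> pieces
      \<longleftrightarrow> int (p * L) < j \<and> (j < int (p * L + p) \<or> (j = int (p * L + p) \<and> n = 0))"
    if n: "n < k" for j n
  proof -
    have "y \<in> X (Suc m)" unfolding y_eq using k_ge2 by (intro pt_in_X) simp
    then have "\<not> (pt (Suc m) j n < y \<and> y < pt (Suc m) j (Suc n))"
      using no_point_between[OF n, of "Suc m" j] by auto
    then have "(pt (Suc m) j n, pt (Suc m) j (Suc n)) \<in> pieces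
        \<longleftrightarrow> \<not> pt (Suc m) j n < x \<and> pt (Suc m) j n < y"
      unfolding pieces_def lifted_arcs_eq using n pt_less_Suc[of "Suc m" j n] by auto
    also have "pt (Suc m) j n < x \<longleftrightarrow> j < int (p * L) + 1"
      unfolding x_eq using n k_ge2 by (subst pt_less_iff) auto
    also have "pt (Suc m) j n < y \<longleftrightarrow> j < int (p * L + p) \<or> (j = int (p * L + p) \<and> n = 0)"
      unfolding y_eq using n k_ge2 by (subst pt_less_iff) auto
    finally show ?thesis by auto
  qed
  have piece_cases: "\<exists>j n. e = (pt (Suc m) j n, pt (Suc m) j (Suc n)) \<and> n < k" if "e \<in> pieces" for e
    using that unfolding pieces_def lifted_arcs_eq by auto
  let ?e = "\<lambda>i. (pt (Suc m) (int (p * L + Suc i)) 0, pt (Suc m) (int (p * L + Suc i)) 1)"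
  have type_0: "{e \<in> pieces. of_type p k (Suc m) 0 e} = ?e ` {..<p}"
  proof (intro subset_antisym subsetI)
    fix e
    assume "e \<in> {e \<in> pieces. of_type p k (Suc m) 0 e}"
    then have e_in: "e \<in> pieces" and "of_type p k (Suc m) 0 e" by auto
    then obtain j where e: "e = (pt (Suc m) j 0, pt (Suc m) j (Suc 0))"
      using piece_cases[OF e_in] by (auto simp: of_type_arc)
    then have "int (p * L) < j" "j \<le> int (p * L + p)"
      using piece_iff[of 0 j] e_in k_ge2 by auto
    moreover define i where "i = nat (j - int (p * L) - 1)"
    ultimately have j: "j = int (p * L + Suc i)" and "i < p"
      by auto
    then show "e \<in> ?e ` {..<p}" by (intro image_eqI[of _ _ i]) (simp_all add: e)
  next
    fix e
    assume "e \<in> ?e ` {..<p}"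
    then show "e \<in> {e \<in> pieces. of_type p k (Suc m) 0 e}"
      using piece_iff[of 0] of_type_arc[of "Suc m" 0 _ 0] k_ge2 by auto
  qed
  have "inj_on ?e {..<p}"
    using pt_eq_iff[of 0 0 "Suc m"] k_ge2 by (auto simp: inj_on_def)
  then show "card {e \<in> pieces. of_type p k (Suc m) 0 e} = p"
    unfolding type_0 by (simp add: card_image)
  show "\<forall>(s, t) \<in> pieces. \<not> of_type p k (Suc m) 0 (s, t) \<longrightarrow> identified p k s t"
  proof clarify
    fix s t
    assume st_in: "(s, t) \<in> pieces" and "\<not> of_type p k (Suc m) 0 (s, t)"
    then obtain j n where st: "s = pt (Suc m) j n" "t = pt (Suc m) j (Suc n)" and n: "n < k" "n \<noteq> 0"
      using piece_cases[OF st_in] by (auto simp: of_type_arc)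
    then have "int (p * L) < j" "j < int (p * L + p)"
      using piece_iff[OF n(1), of j] st_in by auto
    then have "\<not> int p dvd j"
      using not_dvd_block[of "nat (j - int (p * L))" "int L"] by (simp add: nat_less_iff)
    then show "identified p k s t"
      unfolding st using n by (intro identified_block) auto
  qed
  show "\<forall>(s, t) \<in> pieces. of_type p k (Suc m) 0 (s, t) \<longrightarrow> w t - w s = 1 / real p * (u y - u x)"
  proof clarify
    fix s t
    assume "(s, t) \<in> pieces" "of_type p k (Suc m) 0 (s, t)"
    then have "(s, t) \<in> ?e ` {..<p}" using type_0 by blast
    then obtain i where i: "i < p" and s: "s = pt (Suc m) (int (p * L + Suc i)) 0"
      and t: "t = pt (Suc m) (int (p * L + Suc i)) 1" by auto
    have "w s = chain w m L i"
      unfolding s using chain_eq[OF ext i] pt_wrap[of "Suc m" "int (p * L + i)"]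
      by (simp add: add.commute)
    moreover have "w t = chain w m L (Suc i)"
      unfolding t chain_def by simp
    ultimately have "w t - w s = jump u m L / real p"
      using \<open>defect u w m = 0\<close> L i unfolding defect_eq_0_iff by simp
    then show "w t - w s = 1 / real p * (u y - u x)"
      using x y k_ge2 by (simp add: jump_def)
  qed
qed

subsection \<open>Renormalized energy\<close>

abbreviation "r \<equiv> r_const p k"
abbreviation "bw \<equiv> b_weights p k"

lemma r_pos: "0 < r"
  using p_pos by (simp add: r_const_def)

lemma r_power_k: "r ^ k = real p ^ (k - 1)"
proof -
  have "r ^ k = r powr real k" using r_pos by (simp add: powr_realpow)
  also have "\<dots> = real p powr real (k - 1)"
    using k_ge2 p_pos by (simp add: r_const_def powr_powr of_nat_diff)
  also have "\<dots> = real p ^ (k - 1)" using p_pos by (simp add: powr_realpow)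
  finally show ?thesis .
qed

lemma r_times_last: "r * r ^ (k - 1) = real p ^ (k - 1)"
  using r_power_k power_Suc[of r "k - 1"] k_ge2 by simp

lemma p_sq_over_r: "real p ^ 2 / r = real p powr ((real k + 1) / real k)"
proof -
  have "real p ^ 2 / r = real p powr 2 / real p powr ((real k - 1) / real k)"
    using p_pos powr_realpow[of "real p" 2] by (simp add: r_const_def)
  also have "\<dots> = real p powr (2 - (real k - 1) / real k)"
    by (simp add: powr_diff)
  also have "2 - (real k - 1) / real k = (real k + 1) / real k"
    using k_ge2 by (simp add: field_simps)
  finally show ?thesis .
qed

lemma weights_pos: "positive_weights k bw"
  using r_pos by (simp add: positive_weights_def b_weights_def)

lemma weights_eigen:
  assumes "n < k"
  shows "r * bw n = (\<Sum>n'<k. bw n' * M_entry p k n' n)"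
  using r_times_last by (simp add: sum_M_entry_column[OF assms] b_weights_def)

text \<open>All columns but the last give \<open>b (n + 1) = s * b n\<close>, so the weights are
  geometric. The last column closes the cycle with \<open>s^k = p^(k-1)\<close>, which has one
  positive root.\<close>

lemma eigen_unique:
  assumes "0 < s" and b: "positive_weights k b"
    and eigen: "\<forall>n<k. s * b n = (\<Sum>n'<k. b n' * M_entry p k n' n)"
  shows "s = r" "\<exists>c>0. \<forall>n<k. b n = c * bw n"
proof -
  have b0: "0 < b 0" using b k_ge2 by (simp add: positive_weights_def)
  have step: "b (Suc n) = s * b n" if "Suc n < k" for n
    using eigen[rule_format, of n] that sum_M_entry_column[of n b] by auto
  have last: "s * b (k - 1) = b 0 * real p ^ (k - 1)"
    using eigen[rule_format, of "k - 1"] k_ge2 by (simp add: sum_M_entry_column)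
  have geom: "b n = b 0 * s ^ n" if "n < k" for n
    using that by (induction n) (auto simp: step)
  have "b 0 * s ^ k = s * b (k - 1)"
    using geom[of "k - 1"] k_ge2 by (cases k) auto
  then have "s ^ k = r ^ k" using last b0 r_power_k by simp
  then show "s = r"
    using \<open>0 < s\<close> r_pos k_ge2 by (intro power_eq_imp_eq_base[of s k r]) auto
  then show "\<exists>c>0. \<forall>n<k. b n = c * bw n"
    using b0 geom unfolding b_weights_def by blast
qed

text \<open>The eigenvector equation turns every coefficient of the transferred energy into
  \<open>r\<close> times the old one; the last type uses
  \<open>r * r^(k-1) = p^(k-1)\<close>.\<close>

lemma E_weighted_step:
  assumes "extension p k (Suc m) u w"
  shows "E_weighted p k bw (Suc m) w = r * E_weighted p k bw m u + defect u w m"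
proof -
  have "E_weighted p k bw m u
      = (\<Sum>n<k - 1. bw n * E_type p k m n u) + bw (k - 1) * E_type p k m (k - 1) u"
    unfolding E_weighted_def
    using sum.lessThan_Suc[of "\<lambda>n. bw n * E_type p k m n u" "k - 1"] k_ge2 by simp
  then show ?thesis
    using r_times_last
    by (simp add: E_weighted_extension[OF assms] b_weights_def distrib_left sum_distrib_left mult.assoc[symmetric])
qed

lemma E_renorm_step:
  assumes "extension p k (Suc m) u w"
  shows "E_renorm p k (Suc m) w = E_renorm p k m u + defect u w m / r ^ Suc m"
  using r_pos by (simp add: E_renorm_def E_weighted_step[OF assms] add_divide_distrib)

lemma respects_subset: "respects_on p k S u \<Longrightarrow> T \<subseteq> S \<Longrightarrow> respects_on p k T u"
  unfolding respects_on_def by blast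

text \<open>A function on the circle extends its own restrictions, so \<open>E_renorm_step\<close>
  with its nonnegative defect makes the renormalized energies increase.\<close>

lemma extension_self: "respects_ident p k u \<Longrightarrow> extension p k m u u"
  using respects_subset[of UNIV u] by (simp add: extension_def)

lemma incseq_E_renorm:
  assumes "respects_ident p k u"
  shows "incseq (\<lambda>m. E_renorm p k m u)"
proof (rule incseq_SucI)
  fix m
  have "0 \<le> defect u u m / r ^ Suc m"
    using r_pos defect_nonneg by (intro divide_nonneg_nonneg) auto
  then show "E_renorm p k m u \<le> E_renorm p k (Suc m) u"
    using E_renorm_step[OF extension_self[OF assms]] by simp
qed

lemma E_type_nonneg: "n < k \<Longrightarrow> 0 \<le> E_type p k m n u"
  using inv_length_pos[of m n] by (simp add: E_type_eq sum_nonneg)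

lemma E_renorm_nonneg: "0 \<le> E_renorm p k m u"
  unfolding E_renorm_def E_weighted_def b_weights_def using r_pos
  by (intro divide_nonneg_nonneg sum_nonneg mult_nonneg_nonneg E_type_nonneg) auto

lemma energy_tendsto:
  assumes "respects_ident p k u"
  shows "(\<lambda>m. ereal (E_renorm p k m u)) \<longlonglongrightarrow> energy p k u"
proof -
  have "incseq (\<lambda>m. ereal (E_renorm p k m u))"
    using incseq_E_renorm[OF assms] by (simp add: incseq_def)
  then have "(\<lambda>m. ereal (E_renorm p k m u)) \<longlonglongrightarrow> (SUP m. ereal (E_renorm p k m u))"
    by (rule LIMSEQ_SUP)
  then show ?thesis unfolding energy_def by (simp add: limI)
qed

lemma E_renorm_le_energy:
  assumes "respects_ident p k u"
  shows "ereal (E_renorm p k m u) \<le> energy p k u"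
  using incseq_E_renorm[OF assms] by (intro incseq_le energy_tendsto assms) (simp add: incseq_def)

lemma energy_nonneg: "respects_ident p k u \<Longrightarrow> 0 \<le> energy p k u"
  using E_renorm_le_energy[of u 0] E_renorm_nonneg[of 0 u]
  by (metis ereal_less_eq(5) order_trans)

text \<open>All coefficients are positive, so \<open>u\<close> has no difference along any edge, and
  walking along consecutive edges reaches every point.\<close>

lemma E_renorm_eq_0D:
  assumes u: "respects_on p k (X m) u" and "E_renorm p k m u = 0" and "x \<in> X m"
  shows "u x = u (pt m 0 0)"
proof -
  have "(\<Sum>n<k. bw n * E_type p k m n u) = 0"
    using assms(2) r_pos by (simp add: E_renorm_def E_weighted_def)
  then have "bw n * E_type p k m n u = 0" if "n < k" for n
    using that r_pos E_type_nonneg by (subst (asm) sum_nonneg_eq_0_iff) (auto simp: b_weights_def)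
  then have "E_type p k m n u = 0" if "n < k" for n
    using that r_pos by (force simp: b_weights_def)
  then have "(\<Sum>j<p ^ m. (u (pt m (int j) (Suc n)) - u (pt m (int j) n))\<^sup>2) = 0" if "n < k" for n
    using that inv_length_pos[of m n] by (force simp: E_type_eq)
  then have edge: "u (pt m (int j) (Suc n)) = u (pt m (int j) n)" if "n < k" "j < p ^ m" for n j
    using that by (subst (asm) sum_nonneg_eq_0_iff) auto
  have pm: "0 < int p ^ m" using p_ge2 by simp
  have step: "u (pt m j (Suc n)) = u (pt m j n)" if "n < k" for n j
  proof -
    define j' where "j' = nat (j mod int p ^ m)"
    have j': "int j' = j mod int p ^ m" using pm by (simp add: j'_def)
    then have "int j' < int (p ^ m)" using pm by simp
    then have "j' < p ^ m" by linarith
    then have "u (pt m (int j') (Suc n)) = u (pt m (int j') n)" using edge that by blast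
    then show ?thesis
      using respects_periodic_mod[OF u, of _ j] that by (simp add: j')
  qed
  have in_block: "u (pt m j n) = u (pt m j 0)" if "n \<le> k" for n j
    using that by (induction n) (auto simp: step)
  have "u (pt m (j + 1) 0) = u (pt m j 0)" for j
    using in_block[of k j] by (simp add: pt_wrap)
  then have "u (pt m j 0) = u (pt m 0 0)" for j
  proof (induction j rule: int_induct[of _ 0])
    case (step2 i)
    then show ?case by (metis diff_add_cancel)
  qed auto
  then show ?thesis
    using \<open>x \<in> X m\<close> in_block by (metis X_points_cases)
qed

lemma X_points_mono: "m \<le> m' \<Longrightarrow> X m \<subseteq> X m'"
  by (rule lift_Suc_mono_le[of "\<lambda>m. X m"]) (rule X_points_mono_Suc)

lemma E_renorm_const:
  assumes "\<forall>x\<in>X m. u x = c"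
  shows "E_renorm p k m u = 0"
proof -
  have "E_type p k m n u = 0" if "n < k" for n
    using that assms pt_in_X[of _ m] by (simp add: E_type_eq)
  then show ?thesis by (simp add: E_renorm_def E_weighted_def)
qed

lemma energy_eq_0_iff:
  assumes u: "respects_ident p k u"
  shows "energy p k u = 0 \<longleftrightarrow> (\<exists>c. \<forall>m\<ge>1. \<forall>x\<in>X m. u x = c)"
proof
  assume "energy p k u = 0"
  then have zero: "E_renorm p k m u = 0" for m
    using E_renorm_le_energy[OF u, of m] E_renorm_nonneg[of m u] by simp
  have "u x = u (pt 0 0 0)" if "x \<in> X m" for m x
  proof -
    \<comment> \<open>A base point common to all levels makes the constant independent of
      \<open>m\<close>.\<close>
    have "pt 0 0 0 \<in> X m" using X_points_mono[of 0 m] pt_in_X[of 0 0 0] by auto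
    then show ?thesis
      using E_renorm_eq_0D[OF respects_subset[OF u] zero] that by (metis subset_UNIV)
  qed
  then show "\<exists>c. \<forall>m\<ge>1. \<forall>x\<in>X m. u x = c" by blast
next
  assume "\<exists>c. \<forall>m\<ge>1. \<forall>x\<in>X m. u x = c"
  then have "E_renorm p k m u = 0" if "1 \<le> m" for m using E_renorm_const that by blast
  then have "(\<lambda>m. ereal (E_renorm p k m u)) \<longlonglongrightarrow> 0"
    by (intro tendsto_eventually eventually_sequentiallyI[of 1]) simp
  then show "energy p k u = 0" using energy_tendsto[OF u] by (blast intro: LIMSEQ_unique)
qed

text \<open>The graph points are dense: level \<open>m\<close> has a point within
  \<open>p^(-m)\<close> of \<open>t\<close>.\<close>

lemma const_of_const_on_points:
  fixes u :: "real \<Rightarrow> real"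
  assumes "continuous_on UNIV u" and c: "\<forall>m\<ge>1. \<forall>x\<in>X m. u x = c"
  shows "u t = c"
proof -
  define x where "x m = pt m \<lfloor>real p ^ m * t\<rfloor> 0" for m
  have close: "norm (x m - t) \<le> (1 / real p) ^ m" for m
  proof -
    have pm: "0 < real p ^ m" using p_pos by simp
    have "x m - t = (of_int \<lfloor>real p ^ m * t\<rfloor> - real p ^ m * t + 1 / Q) / real p ^ m"
      using pm by (simp add: x_def pt_def field_simps)
    moreover have "\<bar>of_int \<lfloor>real p ^ m * t\<rfloor> - real p ^ m * t + 1 / Q\<bar> \<le> 1"
    proof -
      have "0 < 1 / Q" "1 / Q < 1"
        using power_over_Q_pos[of 0] power_over_Q_lt1[of 0] k_ge2 by simp_all
      then show ?thesis by linarith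
    qed
    ultimately show ?thesis
      using pm by (simp add: abs_divide power_divide divide_right_mono)
  qed
  have "(\<lambda>m. (1 / real p) ^ m) \<longlonglongrightarrow> 0"
    using p_gt1 by (intro LIMSEQ_power_zero) simp
  then have "(\<lambda>m. x m - t) \<longlonglongrightarrow> 0"
    by (rule Lim_null_comparison[rotated]) (use close in auto)
  then have "x \<longlonglongrightarrow> t" by (simp add: LIM_zero_iff)
  then have "(\<lambda>m. u (x m)) \<longlonglongrightarrow> u t"
    using assms(1) by (simp add: continuous_on_eq_continuous_at isCont_tendsto_compose)
  moreover have "(\<lambda>m. u (x m)) \<longlonglongrightarrow> c"
    using c by (intro tendsto_eventually eventually_sequentiallyI[of 1]) (simp add: x_def pt_in_X)
  ultimately show ?thesis by (rule LIMSEQ_unique)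
qed

lemma energy_eq_0_iff_continuous:
  assumes u: "respects_ident p k u" "continuous_on UNIV u"
  shows "energy p k u = 0 \<longleftrightarrow> (\<exists>c. \<forall>t. u t = c)"
  using energy_eq_0_iff[OF u(1)] const_of_const_on_points[OF u(2)] by blast

section \<open>Bilinear energies and composition with \<open>P\<close>\<close>

definition diff :: "(real \<Rightarrow> real) \<Rightarrow> nat \<Rightarrow> nat \<Rightarrow> int \<Rightarrow> real" where
  "diff u m n j = u (pt m j (Suc n)) - u (pt m j n)"

definition form_type :: "nat \<Rightarrow> nat \<Rightarrow> (real \<Rightarrow> real) \<Rightarrow> (real \<Rightarrow> real) \<Rightarrow> real" where
  "form_type m n u v = (\<Sum>j<p ^ m. diff u m n (int j) * diff v m n (int j)) * inv_length m n"

definition form :: "nat \<Rightarrow> (real \<Rightarrow> real) \<Rightarrow> (real \<Rightarrow> real) \<Rightarrow> real" where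
  "form m u v = (\<Sum>n<k. bw n * form_type m n u v) / r ^ m"

lemma E_type_form: "n < k \<Longrightarrow> E_type p k m n u = form_type m n u u"
  by (simp add: E_type_eq form_type_def diff_def power2_eq_square)

lemma E_renorm_form: "E_renorm p k m u = form m u u"
  by (simp add: E_renorm_def E_weighted_def form_def E_type_form)

lemma form_type_add:
  "form_type m n (\<lambda>t. u t + v t) (\<lambda>t. u t + v t)
    = form_type m n u u + 2 * form_type m n u v + form_type m n v v"
  unfolding form_type_def diff_def
  by (simp add: sum.distrib[symmetric] sum_distrib_left sum_distrib_right algebra_simps
      cong: sum.cong)

lemma form_type_sub:
  "form_type m n (\<lambda>t. u t - v t) (\<lambda>t. u t - v t)
    = form_type m n u u - 2 * form_type m n u v + form_type m n v v"
  unfolding form_type_def diff_def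
  by (simp add: sum.distrib[symmetric] sum_subtractf[symmetric] sum_distrib_left sum_distrib_right
      algebra_simps cong: sum.cong)

lemma E_renorm_add:
  "E_renorm p k m (\<lambda>t. u t + v t) = E_renorm p k m u + 2 * form m u v + E_renorm p k m v"
  by (simp add: E_renorm_form form_def form_type_add sum.distrib sum_distrib_left
      add_divide_distrib algebra_simps)

lemma E_renorm_sub:
  "E_renorm p k m (\<lambda>t. u t - v t) = E_renorm p k m u - 2 * form m u v + E_renorm p k m v"
  by (simp add: E_renorm_form form_def form_type_sub sum.distrib sum_subtractf sum_distrib_left
      add_divide_distrib diff_divide_distrib algebra_simps)

definition avg :: "(real \<Rightarrow> real) \<Rightarrow> real \<Rightarrow> real" where
  "avg v t = (\<Sum>i<p. v ((t + real i) / real p)) / real p"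

lemma respects_translate: "respects_ident p k u \<Longrightarrow> u (t + of_int z) = u t"
  using identified_translate by (auto intro: respects_onD)

lemma comp_circle_map:
  assumes "respects_ident p k u"
  shows "(u \<circ> circle_map p) t = u (real p * t)"
  using respects_translate[OF assms, of "real p * t" "- \<lfloor>real p * t\<rfloor>"]
  by (simp add: circle_map_def frac_def)

lemma respects_comp:
  assumes "respects_ident p k u"
  shows "respects_ident p k (u \<circ> circle_map p)"
  unfolding respects_on_def comp_circle_map[OF assms]
  using identified_scale respects_onD[OF assms] by blast

lemma avg_comp:
  assumes "respects_ident p k u"
  shows "avg (u \<circ> circle_map p) = u"
proof
  fix t
  have "(u \<circ> circle_map p) ((t + real i) / real p) = u t" for i
    using p_pos respects_translate[OF assms, of t "int i"] by (simp add: comp_circle_map[OF assms] del: comp_apply)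
  then show "avg (u \<circ> circle_map p) t = u t"
    using p_pos by (simp add: avg_def del: comp_apply)
qed

text \<open>The \<open>p\<close> preimages of an edge are the edges with block numbers
  \<open>j + p^m i\<close>. On all of them \<open>u\<close> composed with \<open>P\<close> has the
  same difference, while those of \<open>v\<close> add up to \<open>p\<close> times that of
  \<open>avg v\<close>. The second factor \<open>p\<close> comes from the shorter edges.\<close>

lemma form_type_comp:
  assumes u: "respects_ident p k u"
  shows "form_type (Suc m) n (u \<circ> circle_map p) v = real p ^ 2 * form_type m n u (avg v)"
proof -
  have du: "diff (u \<circ> circle_map p) (Suc m) n j = diff u m n j" for j
    by (simp add: diff_def comp_circle_map[OF u] pt_scale del: comp_apply)
  have periodic: "diff u m n (j + int p ^ m * i) = diff u m n j" for i j
    by (simp add: diff_def pt_translate respects_translate[OF u])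
  have dv: "(\<Sum>i<p. diff v (Suc m) n (int j + int p ^ m * int i)) = real p * diff (avg v) m n (int j)" for j
    unfolding diff_def pt_preimage avg_def using p_pos by (simp add: sum_subtractf diff_divide_distrib[symmetric])
  have "(\<Sum>j<p ^ Suc m. diff (u \<circ> circle_map p) (Suc m) n (int j) * diff v (Suc m) n (int j))
      = (\<Sum>i<p. \<Sum>j<p ^ m. diff u m n (int (p ^ m * i + j)) * diff v (Suc m) n (int (p ^ m * i + j)))"
    unfolding du
    using sum_blocks[of "\<lambda>j. diff u m n (int j) * diff v (Suc m) n (int j)" p "p ^ m"] by simp
  also have "\<dots> = (\<Sum>i<p. \<Sum>j<p ^ m. diff u m n (int j) * diff v (Suc m) n (int j + int p ^ m * int i))"
    using periodic by (simp add: add.commute)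
  also have "\<dots> = (\<Sum>j<p ^ m. diff u m n (int j) * (\<Sum>i<p. diff v (Suc m) n (int j + int p ^ m * int i)))"
    by (subst sum.swap) (simp add: sum_distrib_left)
  also have "\<dots> = real p * (\<Sum>j<p ^ m. diff u m n (int j) * diff (avg v) m n (int j))"
    unfolding dv by (simp add: sum_distrib_left algebra_simps)
  finally show ?thesis
    by (simp add: form_type_def inv_length_def power2_eq_square)
qed

lemma form_comp:
  assumes "respects_ident p k u"
  shows "form (Suc m) (u \<circ> circle_map p) v = real p ^ 2 / r * form m u (avg v)"
  by (simp add: form_def form_type_comp[OF assms] sum_distrib_left sum_divide_distrib algebra_simps)

lemma E_type_comp:
  assumes "respects_ident p k u" "n < k"
  shows "E_type p k (Suc m) n (u \<circ> circle_map p) = real p ^ 2 * E_type p k m n u"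
  using form_type_comp[OF assms(1)] avg_comp[OF assms(1)] by (simp add: E_type_form[OF assms(2)])

lemma E_renorm_comp:
  assumes "respects_ident p k u"
  shows "E_renorm p k (Suc m) (u \<circ> circle_map p) = real p ^ 2 / r * E_renorm p k m u"
  using form_comp[OF assms] avg_comp[OF assms] by (simp add: E_renorm_form)

lemma energy_comp:
  assumes u: "respects_ident p k u"
  shows "energy p k (u \<circ> circle_map p) = ereal (real p ^ 2 / r) * energy p k u"
proof (rule LIMSEQ_unique)
  show "(\<lambda>m. ereal (E_renorm p k (Suc m) (u \<circ> circle_map p))) \<longlonglongrightarrow> energy p k (u \<circ> circle_map p)"
    by (rule LIMSEQ_Suc[OF energy_tendsto[OF respects_comp[OF u]]])
  show "(\<lambda>m. ereal (E_renorm p k (Suc m) (u \<circ> circle_map p)))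
      \<longlonglongrightarrow> ereal (real p ^ 2 / r) * energy p k u"
    unfolding E_renorm_comp[OF u] times_ereal.simps(1)[symmetric]
    by (intro tendsto_cmult_ereal energy_tendsto[OF u]) simp
qed

lemma sum_shift_int:
  fixes g :: "int \<Rightarrow> real"
  assumes "\<And>i. g (i + int p) = g i"
  shows "(\<Sum>i<p. g (int i + z)) = (\<Sum>i<p. g (int i))"
proof -
  have step: "(\<Sum>i<p. g (int i + (z + 1))) = (\<Sum>i<p. g (int i + z))" for z
    using sum_shift_periodic[of "\<lambda>i. g (int i + z)" p] assms[of z] by (simp add: algebra_simps)
  show ?thesis
  proof (induction z rule: int_induct[of _ 0])
    case (step1 i)
    then show ?case using step by simp
  next
    case (step2 i)
    then show ?case using step[of "i - 1"] by simp
  qed simp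
qed

text \<open>The preimages of identified points are identified in pairs, one pair in each arc of the
  partition; subtracting \<open>cell 0\<close> numbers the preimages of a point by the arc that contains them.\<close>

lemma identified_preimage:
  assumes "identified p k s t"
  shows "identified p k ((s + of_int (i - cell 0 s)) / real p) ((t + of_int (i - cell 0 t)) / real p)"
  unfolding identified_iff
proof
  fix j
  have c: "cell (Suc j) ((x + of_int (i - cell 0 x)) / real p) = cell j x + int p ^ j * (i - cell 0 x)" for x
    using cell_scale[of j "(x + of_int (i - cell 0 x)) / real p"]
      cell_translate[of j x "i - cell 0 x"] p_pos
    by simp
  show "cell (Suc j) ((s + of_int (i - cell 0 s)) / real p) mod int p
      = cell (Suc j) ((t + of_int (i - cell 0 t)) / real p) mod int p"
  proof (cases j)
    case 0
    then show ?thesis unfolding c by simp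
  next
    case (Suc j')
    then have "cell j s mod int p = cell j t mod int p" using assms identified_iff by blast
    then show ?thesis
      unfolding c using Suc by (simp add: mult.assoc)
  qed
qed

text \<open>The numbering of the preimages may start at any integer; starting at
  \<open>- cell 0\<close> sorts them by arcs of the partition.\<close>

lemma avg_shift:
  assumes "respects_ident p k v"
  shows "avg v t = (\<Sum>i<p. v ((t + of_int (int i + z)) / real p)) / real p"
proof -
  have "v ((t + of_int (i + int p)) / real p) = v ((t + of_int i) / real p)" for i
    using respects_translate[OF assms, of "(t + of_int i) / real p" 1] p_pos
    by (simp add: add_divide_distrib add.assoc)
  then have "(\<Sum>i<p. v ((t + of_int (int i + z)) / real p)) = (\<Sum>i<p. v ((t + of_int (int i)) / real p))"
    by (rule sum_shift_int)
  then show ?thesis by (simp add: avg_def)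
qed

lemma respects_avg:
  assumes "respects_ident p k v"
  shows "respects_ident p k (avg v)"
  unfolding respects_on_def
proof (intro ballI impI)
  fix s t
  assume "identified p k s t"
  then have "v ((s + of_int (int i - cell 0 s)) / real p) = v ((t + of_int (int i - cell 0 t)) / real p)" for i
    using identified_preimage respects_onD[OF assms] by blast
  then show "avg v s = avg v t"
    using avg_shift[OF assms, of s "- cell 0 s"] avg_shift[OF assms, of t "- cell 0 t"] by simp
qed

text \<open>\<open>avg v\<close> composed with \<open>P\<close> acts as an orthogonal projection of
  \<open>v\<close>: its energy equals its form with \<open>v\<close>, so a nonnegative energy of the
  difference gives the bound.\<close>

lemma E_renorm_avg_le:
  assumes "respects_ident p k v"
  shows "real p ^ 2 / r * E_renorm p k m (avg v) \<le> E_renorm p k (Suc m) v"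
proof -
  note w = respects_avg[OF assms]
  let ?U = "avg v \<circ> circle_map p"
  have "0 \<le> E_renorm p k (Suc m) (\<lambda>t. ?U t - v t)" by (rule E_renorm_nonneg)
  also have "\<dots> = E_renorm p k (Suc m) ?U - 2 * form (Suc m) ?U v + E_renorm p k (Suc m) v"
    by (rule E_renorm_sub)
  also have "form (Suc m) ?U v = real p ^ 2 / r * E_renorm p k m (avg v)"
    by (simp add: form_comp[OF w] E_renorm_form)
  finally show ?thesis unfolding E_renorm_comp[OF w] by simp
qed

section \<open>The domain and the limit form\<close>

lemma domI:
  assumes "respects_ident p k u" "continuous_on UNIV u" "\<And>m. E_renorm p k m u \<le> C"
  shows "u \<in> dom_energy p k"
proof -
  have "energy p k u \<le> ereal C"
    using assms(3) by (intro LIMSEQ_le_const2[OF energy_tendsto[OF assms(1)]]) auto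
  then show ?thesis
    using assms by (auto simp: dom_energy_def)
qed

lemma domD:
  assumes "u \<in> dom_energy p k"
  shows "respects_ident p k u" "continuous_on UNIV u"
    and "(\<lambda>m. E_renorm p k m u) \<longlonglongrightarrow> real_of_ereal (energy p k u)"
    and "E_renorm p k m u \<le> real_of_ereal (energy p k u)"
proof -
  show u: "respects_ident p k u" "continuous_on UNIV u"
    using assms by (auto simp: dom_energy_def)
  have "energy p k u = ereal (real_of_ereal (energy p k u))"
    using assms energy_nonneg[OF u(1)] by (cases "energy p k u") (auto simp: dom_energy_def)
  then show lim: "(\<lambda>m. E_renorm p k m u) \<longlonglongrightarrow> real_of_ereal (energy p k u)"
    using energy_tendsto[OF u(1)] by (metis lim_ereal)
  show "E_renorm p k m u \<le> real_of_ereal (energy p k u)"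
    by (rule incseq_le[OF incseq_E_renorm[OF u(1)] lim])
qed

text \<open>By the parallelogram law the energies of sum and difference add up to at most
  \<open>C\<close>, and both are nonnegative.\<close>

lemma dom_add_sub:
  assumes u: "u \<in> dom_energy p k" and v: "v \<in> dom_energy p k"
  shows "(\<lambda>t. u t + v t) \<in> dom_energy p k" "(\<lambda>t. u t - v t) \<in> dom_energy p k"
proof -
  define C where "C = 2 * (real_of_ereal (energy p k u) + real_of_ereal (energy p k v))"
  have sum: "E_renorm p k m (\<lambda>t. u t + v t) + E_renorm p k m (\<lambda>t. u t - v t) \<le> C" for m
    unfolding E_renorm_add E_renorm_sub C_def using domD(4)[OF u, of m] domD(4)[OF v, of m] by simp
  have "respects_ident p k (\<lambda>t. u t + v t)" "respects_ident p k (\<lambda>t. u t - v t)"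
    using domD(1)[OF u] domD(1)[OF v] unfolding respects_on_def by metis+
  moreover have "E_renorm p k m (\<lambda>t. u t + v t) \<le> C" "E_renorm p k m (\<lambda>t. u t - v t) \<le> C" for m
    using sum[of m] E_renorm_nonneg[of m "\<lambda>t. u t + v t"] E_renorm_nonneg[of m "\<lambda>t. u t - v t"]
    by linarith+
  ultimately show "(\<lambda>t. u t + v t) \<in> dom_energy p k" "(\<lambda>t. u t - v t) \<in> dom_energy p k"
    using domD(2)[OF u] domD(2)[OF v] by (auto intro!: domI[where C = C] continuous_intros)
qed

lemma form_tendsto:
  assumes u: "u \<in> dom_energy p k" and v: "v \<in> dom_energy p k"
  shows "(\<lambda>m. form m u v) \<longlonglongrightarrow> energy_form p k u v"
proof -
  have "form m u v = (E_renorm p k m (\<lambda>t. u t + v t) - E_renorm p k m (\<lambda>t. u t - v t)) / 4" for m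
    by (simp add: E_renorm_add E_renorm_sub)
  then show ?thesis
    unfolding energy_form_def
    by (simp only:) (intro tendsto_divide tendsto_diff tendsto_const domD(3) dom_add_sub u v, simp)
qed

lemma dom_comp:
  assumes u: "u \<in> dom_energy p k"
  shows "u \<circ> circle_map p \<in> dom_energy p k"
proof (rule domI[where C = "real p ^ 2 / r * real_of_ereal (energy p k u)"])
  note resp = respects_comp[OF domD(1)[OF u]]
  show "respects_ident p k (u \<circ> circle_map p)" by (rule resp)
  have "continuous_on UNIV (\<lambda>t. u (real p * t))"
    by (rule continuous_on_compose2[OF domD(2)[OF u]]) (auto intro!: continuous_intros)
  then show "continuous_on UNIV (u \<circ> circle_map p)"
    using comp_circle_map[OF domD(1)[OF u]] by (simp add: fun_eq_iff cong: continuous_on_cong)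
  fix m
  \<comment> \<open>Monotonicity raises the level by one, so that the scaling rule also yields a
    bound at level 0.\<close>
  have "E_renorm p k m (u \<circ> circle_map p) \<le> E_renorm p k (Suc m) (u \<circ> circle_map p)"
    using incseq_E_renorm[OF resp] by (rule incseq_SucD)
  also have "\<dots> \<le> real p ^ 2 / r * real_of_ereal (energy p k u)"
    unfolding E_renorm_comp[OF domD(1)[OF u]] using r_pos domD(4)[OF u]
    by (intro mult_left_mono) auto
  finally show "E_renorm p k m (u \<circ> circle_map p) \<le> real p ^ 2 / r * real_of_ereal (energy p k u)" .
qed

lemma dom_avg:
  assumes v: "v \<in> dom_energy p k"
  shows "avg v \<in> dom_energy p k"
proof (rule domI[where C = "real_of_ereal (energy p k v) / (real p ^ 2 / r)"])
  show "respects_ident p k (avg v)" by (rule respects_avg[OF domD(1)[OF v]])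
  have "continuous_on UNIV (\<lambda>t. v ((t + real i) / real p))" for i
    using p_pos by (intro continuous_on_compose2[OF domD(2)[OF v]] continuous_intros) auto
  then show "continuous_on UNIV (avg v)"
    unfolding avg_def using p_pos by (intro continuous_intros) auto
  fix m
  have "real p ^ 2 / r * E_renorm p k m (avg v) \<le> real_of_ereal (energy p k v)"
    using E_renorm_avg_le[OF domD(1)[OF v], of m] domD(4)[OF v, of "Suc m"] by linarith
  moreover have "0 < real p ^ 2 / r" using r_pos p_pos by simp
  ultimately show "E_renorm p k m (avg v) \<le> real_of_ereal (energy p k v) / (real p ^ 2 / r)"
    by (subst pos_le_divide_eq) (simp_all only: mult.commute)
qed

lemma energy_form_comp:
  assumes u: "u \<in> dom_energy p k" and v: "v \<in> dom_energy p k"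
  shows "energy_form p k (u \<circ> circle_map p) v = real p ^ 2 / r * energy_form p k u (avg v)"
proof (rule LIMSEQ_unique)
  show "(\<lambda>m. form (Suc m) (u \<circ> circle_map p) v) \<longlonglongrightarrow> energy_form p k (u \<circ> circle_map p) v"
    by (rule LIMSEQ_Suc[OF form_tendsto[OF dom_comp[OF u] v]])
  show "(\<lambda>m. form (Suc m) (u \<circ> circle_map p) v) \<longlonglongrightarrow> real p ^ 2 / r * energy_form p k u (avg v)"
    unfolding form_comp[OF domD(1)[OF u]]
    by (intro tendsto_mult_left form_tendsto[OF u dom_avg[OF v]])
qed

subsection \<open>The Laplacian\<close>

lemma has_integral_circle_iff:
  "has_bochner_integral circle_measure f (c :: real)
    \<longleftrightarrow> has_bochner_integral lebesgue (\<lambda>t. indicator {0..<1} t * f t) c"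
  unfolding circle_measure_def by (simp add: has_bochner_integral_restrict_space)

text \<open>On each of the \<open>p\<close> intervals \<open>[i/p, (i+1)/p)\<close> substitute \<open>s = p t - i\<close>.\<close>

lemma has_integral_comp:
  assumes f: "respects_ident p k f" "integrable circle_measure f" and v: "continuous_on UNIV v"
  shows "has_bochner_integral circle_measure (\<lambda>t. (f \<circ> circle_map p) t * v t)
    (LINT s|circle_measure. f s * avg v s)"
proof -
  define F where "F s = indicator {0..<1} s * f s" for s :: real
  define H where "H i s = F s * v ((s + real i) / real p)" for i s
  have v_i: "continuous_on UNIV (\<lambda>s. v ((s + real i) / real p))" for i
    using p_pos by (intro continuous_on_compose2[OF v] continuous_intros) auto
  have F: "integrable lebesgue F"
    using has_integral_circle_iff[of f "LINT s|circle_measure. f s"] f(2)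
    unfolding F_def by (auto simp: has_bochner_integral_iff)
  have H: "integrable lebesgue (H i)" for i
  proof -
    \<comment> \<open>\<open>f\<close> is merely integrable, so the product needs a bounded factor;
      it comes from compactness of the closed interval.\<close>
    have "bounded ((\<lambda>s. v ((s + real i) / real p)) ` {0..1})"
      by (intro compact_imp_bounded compact_continuous_image continuous_on_subset[OF v_i]) auto
    then obtain B where B: "\<forall>s\<in>{0..1}. \<bar>v ((s + real i) / real p)\<bar> \<le> B"
      by (auto simp: bounded_iff)
    show ?thesis
    proof (rule Bochner_Integration.integrable_bound)
      show "integrable lebesgue (\<lambda>s. B * F s)" using F by simp
      have "(\<lambda>s. v ((s + real i) / real p)) \<in> borel_measurable lebesgue"
        using borel_measurable_continuous_onI[OF v_i] by (simp add: measurable_completion)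
      then show "H i \<in> borel_measurable lebesgue"
        using F unfolding H_def by (intro borel_measurable_times) auto
      have "norm (H i s) \<le> norm (B * F s)" for s
      proof (cases "s \<in> {0..<1}")
        case True
        then have "\<bar>v ((s + real i) / real p)\<bar> \<le> \<bar>B\<bar>" using bspec[OF B, of s] by simp
        then show ?thesis
          by (simp add: H_def abs_mult mult.commute[of "\<bar>F s\<bar>"] mult_right_mono)
      qed (simp add: H_def F_def)
      then show "AE s in lebesgue. norm (H i s) \<le> norm (B * F s)" by simp
    qed
  qed
  have "has_bochner_integral lebesgue (\<lambda>t. H i (- real i + real p * t)) (integral\<^sup>L lebesgue (H i) / real p)" for i
    using has_bochner_integral_lebesgue_real_affine_iff[of "real p" "H i" "integral\<^sup>L lebesgue (H i)" "- real i"]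
      H[of i] p_pos by (simp add: has_bochner_integral_iff divide_inverse mult.commute)
  then have "has_bochner_integral lebesgue (\<lambda>t. \<Sum>i<p. H i (- real i + real p * t))
      (\<Sum>i<p. integral\<^sup>L lebesgue (H i) / real p)"
    by (rule has_bochner_integral_sum)
  moreover have "(\<Sum>i<p. H i (- real i + real p * t))
      = indicator {0..<1} t * ((f \<circ> circle_map p) t * v t)" for t
  proof -
    have H_eq: "H i (- real i + real p * t)
        = indicator {0..<1} (- real i + real p * t) * ((f \<circ> circle_map p) t * v t)" for i
      using respects_translate[OF f(1), of "real p * t" "- int i"] p_pos
      by (simp add: H_def F_def comp_circle_map[OF f(1)] add.commute del: comp_apply)
    \<comment> \<open>For \<open>t\<close> in [0, 1) only the shift by the integer part of
      \<open>p t\<close> lands in [0, 1); for other \<open>t\<close> none with \<open>i < p\<close>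
      does.\<close>
    have ind: "(\<Sum>i<p. indicator {0..<1} (- real i + real p * t)) = (indicator {0..<1} t :: real)"
    proof (cases "t \<in> {0..<1}")
      case True
      define l where "l = nat \<lfloor>real p * t\<rfloor>"
      have "0 \<le> real p * t" using True p_pos by simp
      then have l: "real l \<le> real p * t" "real p * t < real l + 1"
        unfolding l_def by linarith+
      have "real p * t < real p" using True p_pos by simp
      then have "l < p" using l by linarith
      have "indicator {0..<1} (- real i + real p * t) = (if i = l then 1 else 0 :: real)" for i
        using l by (auto simp: indicator_def)
      then show ?thesis using \<open>l < p\<close> True by simp
    next
      case False
      have "indicator {0..<1} (- real i + real p * t) = (0 :: real)" if "i < p" for i
      proof -
        have "t < 0 \<or> 1 \<le> t" using False by auto
        then have "real p * t < 0 \<or> real p \<le> real p * t"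
          using p_pos by (auto simp: mult_less_0_iff)
        moreover have "real i + 1 \<le> real p" using that by linarith
        ultimately have "- real i + real p * t < 0 \<or> 1 \<le> - real i + real p * t" by linarith
        then show ?thesis by (auto simp: indicator_def)
      qed
      then show ?thesis using False by simp
    qed
    show ?thesis unfolding H_eq sum_distrib_right[symmetric] ind ..
  qed
  moreover have "(\<Sum>i<p. integral\<^sup>L lebesgue (H i) / real p) = (LINT s|circle_measure. f s * avg v s)"
  proof -
    have "(\<Sum>i<p. integral\<^sup>L lebesgue (H i) / real p) = integral\<^sup>L lebesgue (\<lambda>s. (\<Sum>i<p. H i s) / real p)"
      using H by (simp add: sum_divide_distrib)
    also have "(\<lambda>s. (\<Sum>i<p. H i s) / real p) = (\<lambda>s. indicator {0..<1} s * (f s * avg v s))"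
      by (simp add: fun_eq_iff H_def F_def avg_def sum_distrib_left mult.assoc)
    also have "integral\<^sup>L lebesgue \<dots> = (LINT s|circle_measure. f s * avg v s)"
      unfolding circle_measure_def by (simp add: integral_restrict_space)
    finally show ?thesis .
  qed
  ultimately show ?thesis unfolding has_integral_circle_iff by simp
qed

section \<open>Assembling the statements\<close>

lemma harmonic_extension_properties:
  assumes "2 \<le> m" and "respects_on p k (X_points p k (m - 1)) u"
  shows "\<exists>w.
    (\<forall>b. positive_weights k b \<longrightarrow>
       harmonic_extension p k b m u w \<and>
       (\<forall>w'. harmonic_extension p k b m u w' \<longrightarrow> (\<forall>x\<in>X_points p k m. w' x = w x))) \<and>
    (\<forall>x y. (x, y) \<in> X_edges p k (m - 1) \<and> of_type p k (m - 1) (k - 1) (x, y) \<longrightarrow>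
       (let pieces = {(s, t) \<in> lifted_arcs p k m. {s..t} \<subseteq> {x..y}} in
          card {e \<in> pieces. of_type p k m 0 e} = p \<and>
          (\<forall>(s, t) \<in> pieces. \<not> of_type p k m 0 (s, t) \<longrightarrow> identified p k s t) \<and>
          (\<forall>(s, t) \<in> pieces. of_type p k m 0 (s, t) \<longrightarrow>
             w t - w s = 1 / real p * (u y - u x)))) \<and>
    (\<forall>n'<k. E_type p k m n' w = (\<Sum>n<k. M_entry p k n' n * E_type p k (m - 1) n u))"
proof -
  obtain l where m: "m = Suc l" using assms(1) by (cases m) auto
  have u: "respects_on p k (X l) u" using assms(2) m by simp
  note ext = extension_lin_ext[OF u] and defect = defect_lin_ext[OF u]
  show ?thesis
    unfolding m diff_Suc_1 Let_def
  \<comment> \<open>The witness is fixed before the weights, so one extension serves all of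
    them.\<close>
  proof (intro exI[of _ "lin_ext u l"] conjI allI impI; (elim conjE)?)
    fix b
    assume b: "positive_weights k b"
    show "harmonic_extension p k b (Suc l) u (lin_ext u l)"
      using harmonic_iff[OF u b] ext defect by blast
    fix w'
    assume "harmonic_extension p k b (Suc l) u w'"
    then show "\<forall>x\<in>X (Suc l). w' x = lin_ext u l x"
      using harmonic_iff[OF u b] minimal_defect_imp_eq[OF ext _ defect] by blast
  next
    fix n'
    assume "n' < k"
    then show "E_type p k (Suc l) n' (lin_ext u l) = (\<Sum>n<k. M_entry p k n' n * E_type p k l n u)"
      by (rule E_type_harmonic[OF ext defect])
  qed (rule harmonic_pieces[OF u ext defect]; assumption)+
qed

lemma harmonicD:
  assumes "2 \<le> m \<and> respects_on p k (X_points p k (m - 1)) u \<and> harmonic_extension p k bw m u w"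
  shows "extension p k (Suc (m - 1)) u w" "defect u w (m - 1) = 0" "Suc (m - 1) = m"
  using assms harmonic_iff[of "m - 1" u bw w] weights_pos by auto

text \<open>Testing against \<open>v\<close> is reduced to testing the equation of \<open>u\<close>
  against \<open>avg v\<close>, by adjointness on the energy side and on the integral side. The
  factor \<open>p^2 / r\<close> of the energy remains.\<close>

lemma laplacian_comp:
  assumes "is_laplacian p k u f"
  shows "is_laplacian p k (u \<circ> circle_map p)
    (\<lambda>t. real p powr ((real k + 1) / real k) * (f \<circ> circle_map p) t)"
proof -
  let ?c = "real p powr ((real k + 1) / real k)"
  let ?g = "\<lambda>t. ?c * (f \<circ> circle_map p) t"
  have u: "u \<in> dom_energy p k" and f: "respects_ident p k f" "integrable circle_measure f"
    and lap: "\<And>v. v \<in> dom_energy p k \<Longrightarrow> energy_form p k u v = - (LINT t|circle_measure. f t * v t)"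
    using assms by (auto simp: is_laplacian_def)
  have "respects_ident p k ?g"
    using respects_comp[OF f(1)] unfolding respects_on_def by metis
  moreover have "integrable circle_measure ?g"
    \<comment> \<open>The test function 1 gives the integrability of \<open>f\<close> composed with
      \<open>P\<close>.\<close>
    using has_integral_comp[OF f, of "\<lambda>t. 1"] by (auto simp: has_bochner_integral_iff)
  moreover have "energy_form p k (u \<circ> circle_map p) v = - (LINT t|circle_measure. ?g t * v t)"
    if v: "v \<in> dom_energy p k" for v
  proof -
    have "(LINT t|circle_measure. ?g t * v t) = ?c * (LINT t|circle_measure. (f \<circ> circle_map p) t * v t)"
      by (simp add: mult.assoc)
    also have "(LINT t|circle_measure. (f \<circ> circle_map p) t * v t) = (LINT s|circle_measure. f s * avg v s)"
      by (rule has_bochner_integral_integral_eq[OF has_integral_comp[OF f domD(2)[OF v]]])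
    finally show ?thesis
      unfolding energy_form_comp[OF u v] lap[OF dom_avg[OF v]] p_sq_over_r by simp
  qed
  ultimately show ?thesis
    using dom_comp[OF u] by (simp add: is_laplacian_def)
qed

end

theorem mainTheorem1:
  fixes p k :: nat
  assumes "2 \<le> p" and "2 \<le> k"
  shows
    "\<comment> \<open>(1)\<close>
     (\<forall>m u. 2 \<le> m \<and> respects_on p k (X_points p k (m - 1)) u \<longrightarrow>
       (\<exists>w.
          (\<forall>b. positive_weights k b \<longrightarrow>
             harmonic_extension p k b m u w \<and>
             (\<forall>w'. harmonic_extension p k b m u w' \<longrightarrow> (\<forall>x\<in>X_points p k m. w' x = w x))) \<and>
          (\<forall>x y. (x, y) \<in> X_edges p k (m - 1) \<and> of_type p k (m - 1) (k - 1) (x, y) \<longrightarrow>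
             (let pieces = {(s, t) \<in> lifted_arcs p k m. {s..t} \<subseteq> {x..y}} in
                card {e \<in> pieces. of_type p k m 0 e} = p \<and>
                (\<forall>(s, t) \<in> pieces. \<not> of_type p k m 0 (s, t) \<longrightarrow> identified p k s t) \<and>
                (\<forall>(s, t) \<in> pieces. of_type p k m 0 (s, t) \<longrightarrow>
                   w t - w s = 1 / real p * (u y - u x)))) \<and>
          (\<forall>n'<k. E_type p k m n' w = (\<Sum>n<k. M_entry p k n' n * E_type p k (m - 1) n u))))
    \<and> \<comment> \<open>(2)\<close>
     (0 < r_const p k \<and> positive_weights k (b_weights p k) \<and>
      (\<forall>n<k. r_const p k * b_weights p k n = (\<Sum>n'<k. b_weights p k n' * M_entry p k n' n)) \<and>
      (\<forall>r b. 0 < r \<and> positive_weights k b \<and>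
             (\<forall>n<k. r * b n = (\<Sum>n'<k. b n' * M_entry p k n' n)) \<longrightarrow>
             r = r_const p k \<and> (\<exists>c>0. \<forall>n<k. b n = c * b_weights p k n)) \<and>
      (\<forall>m u w. 2 \<le> m \<and> respects_on p k (X_points p k (m - 1)) u \<and>
               harmonic_extension p k (b_weights p k) m u w \<longrightarrow>
               E_weighted p k (b_weights p k) m w
                 = r_const p k * E_weighted p k (b_weights p k) (m - 1) u))
    \<and> \<comment> \<open>(3)\<close>
     ((\<forall>m u w. 2 \<le> m \<and> respects_on p k (X_points p k (m - 1)) u \<and>
               harmonic_extension p k (b_weights p k) m u w \<longrightarrow>
               E_renorm p k m w = E_renorm p k (m - 1) u) \<and>
      (\<forall>u. respects_ident p k u \<longrightarrow>
           (\<lambda>m. ereal (E_renorm p k m u)) \<longlonglongrightarrow> energy p k u \<and> 0 \<le> energy p k u \<and>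
           (energy p k u = 0 \<longleftrightarrow> (\<exists>c. \<forall>m\<ge>1. \<forall>x\<in>X_points p k m. u x = c))) \<and>
      (\<forall>u. respects_ident p k u \<and> continuous_on UNIV u \<longrightarrow>
           (energy p k u = 0 \<longleftrightarrow> (\<exists>c. \<forall>t. u t = c))))
    \<and> \<comment> \<open>(4)\<close>
     (\<forall>u. respects_ident p k u \<longrightarrow>
        (\<forall>m\<ge>2. (\<forall>n<k. E_type p k m n (u \<circ> circle_map p) = real p ^ 2 * E_type p k (m - 1) n u) \<and>
               (\<forall>b. positive_weights k b \<longrightarrow>
                  E_weighted p k b m (u \<circ> circle_map p) = real p ^ 2 * E_weighted p k b (m - 1) u)) \<and>
        energy p k (u \<circ> circle_map p) = ereal (real p ^ 2 / r_const p k) * energy p k u \<and>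
        energy p k (u \<circ> circle_map p) = ereal (real p powr ((real k + 1) / real k)) * energy p k u)
    \<and> \<comment> \<open>(5)\<close>
     (\<forall>u f. is_laplacian p k u f \<longrightarrow>
        is_laplacian p k (u \<circ> circle_map p)
          (\<lambda>t. real p powr ((real k + 1) / real k) * (f \<circ> circle_map p) t))"
proof -
  interpret julia_model p k using assms by unfold_locales
  show ?thesis
  proof (intro conjI, goal_cases)
    case 1
    show ?case by (intro allI impI, elim conjE) (rule harmonic_extension_properties)
  next
    case 2
    show ?case by (rule r_pos)
  next
    case 3
    show ?case by (rule weights_pos)
  next
    case 4
    show ?case using weights_eigen by blast
  next
    case 5
    show ?case using eigen_unique by blast
  next
    case 6
    show ?case
    proof (intro allI impI)
      fix m u w
      assume h: "2 \<le> m \<and> respects_on p k (X_points p k (m - 1)) u \<and>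
               harmonic_extension p k (b_weights p k) m u w"
      show "E_weighted p k (b_weights p k) m w = r_const p k * E_weighted p k (b_weights p k) (m - 1) u"
        using E_weighted_step[OF harmonicD(1)[OF h]] harmonicD(2,3)[OF h] by simp
    qed
  next
    case 7
    show ?case
    proof (intro allI impI)
      fix m u w
      assume h: "2 \<le> m \<and> respects_on p k (X_points p k (m - 1)) u \<and>
               harmonic_extension p k (b_weights p k) m u w"
      show "E_renorm p k m w = E_renorm p k (m - 1) u"
        using E_renorm_step[OF harmonicD(1)[OF h]] harmonicD(2,3)[OF h] by simp
    qed
  next
    case 8
    show ?case by (intro allI impI conjI energy_tendsto energy_nonneg energy_eq_0_iff)
  next
    case 9
    show ?case by (intro allI impI, elim conjE) (rule energy_eq_0_iff_continuous)
  next
    case 10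
    show ?case
    proof (intro allI impI conjI)
      fix u
      assume u: "respects_ident p k u"
      show "energy p k (u \<circ> circle_map p) = ereal (real p ^ 2 / r_const p k) * energy p k u"
        by (rule energy_comp[OF u])
      then show "energy p k (u \<circ> circle_map p) = ereal (real p powr ((real k + 1) / real k)) * energy p k u"
        by (simp only: p_sq_over_r)
      fix m :: nat
      assume "2 \<le> m"
      then have m: "m = Suc (m - 1)" by simp
      show comp: "E_type p k m n (u \<circ> circle_map p) = real p ^ 2 * E_type p k (m - 1) n u" if "n < k" for n
        using E_type_comp[OF u that, of "m - 1"] m by simp
      show "E_weighted p k b m (u \<circ> circle_map p) = real p ^ 2 * E_weighted p k b (m - 1) u" for b
        by (simp add: E_weighted_def comp sum_distrib_left mult.left_commute)
    qed
  next
    case 11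
    show ?case using laplacian_comp by blast
  qed
qed
end
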